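(* There is an algorithm that, given an acyclic digraph $D$ on $n$ vertices and a positive integer $k$, decides in time $2^{O(k\log k)}\cdot n^{O(1)}$ whether $D$ contains an out-branching with at least $k$ leaves. In other words, on acyclic digraphs the problem $k$-DMLOB can be solved in time $2^{O(k\log k)}\cdot n^{O(1)}$.
   Context: Digraphs are finite, without loops and without parallel arcs. A subdigraph $T$ of $D$ is an out-tree if $T$ is an oriented tree (its underlying undirected graph is a tree) with exactly one vertex of in-degree zero in $T$, called the root. An out-branching of $D$ is an out-tree $T$ in $D$ with $V(T)=V(D)$. The leaves of $T$ are the vertices of out-degree zero in $T$. The parameterized problem $k$-DMLOB (Directed Maximum Leaf Out-Branching) is: given a digraph $D$ and a positive integer parameter $k$, does $D$ contain an out-branching with at least $k$ leaves? *)

theory Defs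
  imports
    Complex_Main
    "HOL-Library.Landau_Symbols"
    "Graph_Theory.Graph_Theory"
begin

section \<open>Out-branchings\<close>

definition acyclic_digraph :: "('a, 'b) pre_digraph \<Rightarrow> bool" where
  "acyclic_digraph D \<longleftrightarrow> digraph D \<and> \<not> (\<exists>p. pre_digraph.cycle D p)"

text \<open>
  In the symmetric digraph of an undirected graph every edge is traversed back and forth by a
  directed cycle of length 2, so the cycles of the undirected graph are the cycles of length at
  least 3. For the same reason the library predicate \<open>tree\<close> cannot be applied to
  \<open>mk_symmetric T\<close>, and applied to \<open>T\<close> itself it would only exclude directed cycles.
  An oriented tree has no pair of opposite arcs. By \<open>connected\<close> it is not empty.
\<close>

definition oriented_tree :: "('a, 'b) pre_digraph \<Rightarrow> bool" where
  "oriented_tree T \<longleftrightarrow>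
     digraph T \<and>
     (\<forall>u v. u \<rightarrow>\<^bsub>T\<^esub> v \<longrightarrow> \<not> v \<rightarrow>\<^bsub>T\<^esub> u) \<and>
     connected T \<and>
     \<not> (\<exists>p. pre_digraph.cycle (with_proj (mk_symmetric T)) p \<and> 3 \<le> length p)"

definition out_tree :: "('a, 'b) pre_digraph \<Rightarrow> bool" where
  "out_tree T \<longleftrightarrow> oriented_tree T \<and> (\<exists>!r. r \<in> verts T \<and> in_degree T r = 0)"

definition out_branching :: "('a, 'b) pre_digraph \<Rightarrow> ('a, 'b) pre_digraph \<Rightarrow> bool" where
  "out_branching T D \<longleftrightarrow> spanning T D \<and> out_tree T"

definition leaves :: "('a, 'b) pre_digraph \<Rightarrow> 'a set" where
  "leaves T = {v \<in> verts T. out_degree T v = 0}"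

definition DMLOB :: "('a, 'b) pre_digraph \<Rightarrow> nat \<Rightarrow> bool" where
  "DMLOB D k \<longleftrightarrow> (\<exists>T. out_branching T D \<and> k \<le> card (leaves T))"


section \<open>Random access machines\<close>

text \<open>
  Algorithms are structured programs for a random access machine with natural-number registers and
  a separate memory of natural-number cells that is accessed by indirect addressing. Every
  instruction and every test of a branch or loop condition takes one unit of time. The only
  arithmetic operations are addition and truncated subtraction, so that a number can grow by at
  most one bit per step and the unit-cost measure is polynomially related to Turing machine time.
  A program mentions only finitely many registers.
\<close>

datatype com =
    LIT nat nat
  | ADD nat nat nat
  | SUB nat nat nat
  | LOAD nat nat
  | STORE nat nat
  | SEQ com com
  | IFNZ nat com com
  | WHILENZ nat com

type_synonym ram_state = "(nat \<Rightarrow> nat) \<times> (nat \<Rightarrow> nat)"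

text \<open>
  \<open>exec c s t s'\<close>: the program \<open>c\<close>, started in state \<open>s\<close>, halts after
  exactly \<open>t\<close> time units in state \<open>s'\<close>. A state consists of the register contents and
  the memory contents.
\<close>

inductive exec :: "com \<Rightarrow> ram_state \<Rightarrow> nat \<Rightarrow> ram_state \<Rightarrow> bool" where
  Lit: "exec (LIT i c) (R, M) 1 (R(i := c), M)"
| Add: "exec (ADD i j l) (R, M) 1 (R(i := R j + R l), M)"
| Sub: "exec (SUB i j l) (R, M) 1 (R(i := R j - R l), M)"
| Load: "exec (LOAD i j) (R, M) 1 (R(i := M (R j)), M)"
| Store: "exec (STORE i j) (R, M) 1 (R, M(R i := R j))"
| Seq: "exec c1 s t1 s' \<Longrightarrow> exec c2 s' t2 s'' \<Longrightarrow> exec (SEQ c1 c2) s (t1 + t2) s''"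
| IfTrue: "R i \<noteq> 0 \<Longrightarrow> exec c1 (R, M) t s' \<Longrightarrow> exec (IFNZ i c1 c2) (R, M) (t + 1) s'"
| IfFalse: "R i = 0 \<Longrightarrow> exec c2 (R, M) t s' \<Longrightarrow> exec (IFNZ i c1 c2) (R, M) (t + 1) s'"
| WhileFalse: "R i = 0 \<Longrightarrow> exec (WHILENZ i c) (R, M) 1 (R, M)"
| WhileTrue: "R i \<noteq> 0 \<Longrightarrow> exec c (R, M) t1 s' \<Longrightarrow> exec (WHILENZ i c) s' t2 s''
    \<Longrightarrow> exec (WHILENZ i c) (R, M) (t1 + t2 + 1) s''"

inductive_cases exec_elims:
  "exec (LIT i c) s t s'"
  "exec (ADD i j l) s t s'"
  "exec (SUB i j l) s t s'"
  "exec (LOAD i j) s t s'"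
  "exec (STORE i j) s t s'"
  "exec (SEQ c1 c2) s t s'"
  "exec (IFNZ i c1 c2) s t s'"
  "exec (WHILENZ i c) s t s'"

lemma exec_deterministic:
  "exec c s t s' \<Longrightarrow> exec c s u s'' \<Longrightarrow> t = u \<and> s' = s''"
proof (induction arbitrary: u s'' rule: exec.induct)
  case (Seq c1 s t1 s' c2 t2 s2)
  from Seq.prems obtain v1 r v2 where
    *: "u = v1 + v2" "exec c1 s v1 r" "exec c2 r v2 s''"
    by (elim exec_elims(6))
  from Seq.IH(1)[OF *(2)] * have "t1 = v1" "exec c2 s' v2 s''" by simp_all
  with Seq.IH(2)[OF this(2)] * show ?case by simp
next
  case (IfTrue R i c1 M t s' c2)
  from IfTrue.prems show ?case by (rule exec_elims(7)) (use IfTrue.hyps in \<open>auto dest: IfTrue.IH\<close>)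
next
  case (IfFalse R i c2 M t s' c1)
  from IfFalse.prems show ?case by (rule exec_elims(7)) (use IfFalse.hyps in \<open>auto dest: IfFalse.IH\<close>)
next
  case (WhileFalse R i c M)
  from WhileFalse.prems show ?case by (rule exec_elims(8)) (use WhileFalse.hyps in auto)
next
  case (WhileTrue R i c M t1 s' t2 s2)
  obtain v1 r v2 where
    *: "u = v1 + v2 + 1" "exec c (R, M) v1 r" "exec (WHILENZ i c) r v2 s''"
    by (rule exec_elims(8)[OF WhileTrue.prems]) (use WhileTrue.hyps(1) in auto)
  from WhileTrue.IH(1)[OF *(2)] * have "t1 = v1" "exec (WHILENZ i c) s' v2 s''" by simp_all
  with WhileTrue.IH(2)[OF this(2)] * show ?case by simp
qed (auto elim: exec_elims(1-5))

text \<open>The answer is read off from register 0: 1 means yes, 0 means no.\<close>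

definition answers_within :: "com \<Rightarrow> ram_state \<Rightarrow> nat \<Rightarrow> bool \<Rightarrow> bool" where
  "answers_within P s t b \<longleftrightarrow>
     (\<exists>t' R M. t' \<le> t \<and> exec P s t' (R, M) \<and> R 0 = (if b then 1 else 0))"

text \<open>
  Encoding of an instance \<open>(D, k)\<close>, where \<open>D\<close> has the vertices \<open>0, \<dots>, n - 1\<close>:
  register 0 holds \<open>n\<close>, register 1 holds \<open>k\<close>, and the memory holds the adjacency matrix
  row by row, the entry for \<open>(u, v)\<close> being at address \<open>u * n + v\<close>. Everything else is 0.
\<close>

definition encode_instance :: "nat pair_pre_digraph \<Rightarrow> nat \<Rightarrow> ram_state" where
  "encode_instance D k =
     (let n = card (pverts D) in
       ((\<lambda>_. 0)(0 := n, 1 := k),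
        \<lambda>a. if (a div n, a mod n) \<in> parcs D then 1 else 0))"

end

theory Submission
  imports Defs "HOL-Library.Nat_Bijection" "HOL-Real_Asymp.Real_Asymp"
begin

text \<open>
  In an acyclic digraph, choosing an in-neighbour for every vertex except the unique source yields an
  out-branching, whose leaves are the vertices that are never chosen. Hence there is an out-branching
  with at least \<open>k\<close> leaves iff some set \<open>L\<close> of at least \<open>k\<close> vertices contains the whole
  in-neighbourhood of exactly one vertex, namely of the source. Such an \<open>L\<close> avoids every sole
  in-neighbour of a vertex. Let \<open>C\<close> be the set of the remaining candidates. Each vertex outside
  \<open>C\<close> is the sole in-neighbour of a vertex of its own, so fewer than \<open>|C|\<close> in-neighbourhoods
  with at least two elements lie within \<open>C\<close>; a hypergraph with so few edges has an independent set
  of size at least \<open>|C| / 3\<close>. So if \<open>|C| \<ge> 3k\<close>, it suffices to count the sources, and otherwise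
  there are at most \<open>8 ^ k\<close> sets \<open>L\<close> to try.
\<close>

section \<open>Out-branchings of acyclic digraphs\<close>

text \<open>Arcs are pairs here, so a walk is determined by its start and the heads of its arcs, and
  the tails form the same list shifted by one. A cycle can then be handled by list indices.\<close>

lemma cas_with_proj_verts:
  assumes "pre_digraph.cas (with_proj G) u p v"
  shows "pre_digraph.awalk_verts (with_proj G) u p = u # map snd p"
    and "map fst p = butlast (u # map snd p)" and "v = last (u # map snd p)"
  using assms
proof (induction p arbitrary: u)
  case Nil
  { case 1 then show ?case by (simp add: pre_digraph.awalk_verts.simps) }
  { case 2 then show ?case by simp }
  { case 3 then show ?case by (simp add: pre_digraph.cas.simps) }
next
  case (Cons e p)
  { case 1 with Cons.IH(1)[of "snd e"] show ?case
      by (simp add: pre_digraph.awalk_verts.simps pre_digraph.cas.simps) }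
  { case 2 with Cons.IH(2)[of "snd e"] show ?case by (simp add: pre_digraph.cas.simps) }
  { case 3 with Cons.IH(3)[of "snd e"] show ?case by (simp add: pre_digraph.cas.simps) }
qed

text \<open>Every nonempty closed walk contains a cycle, so excluding cycles makes the transitive
  closure irreflexive.\<close>

lemma acyclic_digraph_imp_acyclic:
  assumes "acyclic_digraph (with_proj D)"
  shows "acyclic (parcs D)"
proof (rule acyclicI, intro allI notI)
  fix x assume *: "(x, x) \<in> (parcs D)\<^sup>+"
  have dg: "digraph (with_proj D)" and nc: "\<not> (\<exists>p. pre_digraph.cycle (with_proj D) p)"
    using assms by (auto simp: acyclic_digraph_def)
  interpret digraph "with_proj D" by (rule dg)
  have "arcs_ends (with_proj D) = parcs D" by (auto simp: arcs_ends_def arc_to_ends_def)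
  with * have "x \<rightarrow>\<^sup>+\<^bsub>with_proj D\<^esub> x" by simp
  then obtain p where "awalk x p x" "p \<noteq> []" using reachable1_awalk by blast
  then have "closed_w p" by (auto simp: closed_w_def)
  with closed_w_imp_cycle nc show False by blast
qed

text \<open>The number of proper ancestors serves as topological number: along an arc from
  \<open>u\<close> to \<open>v\<close> all ancestors of \<open>u\<close> are ancestors of
  \<open>v\<close>, and \<open>u\<close> itself is an additional one.\<close>

lemma finite_acyclic_topological:
  assumes "finite E" "acyclic E"
  obtains f :: "'a \<Rightarrow> nat" where "\<And>u v. (u, v) \<in> E \<Longrightarrow> f u < f v"
proof
  fix u v assume "(u, v) \<in> E"
  have "finite {w. (w, v) \<in> E\<^sup>+}"
    by (rule finite_subset[of _ "fst ` E\<^sup>+"]) (use assms in \<open>force+\<close>)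
  moreover have "{w. (w, u) \<in> E\<^sup>+} \<subset> {w. (w, v) \<in> E\<^sup>+}"
    using \<open>(u, v) \<in> E\<close> assms(2) by (fastforce simp: acyclic_def)
  ultimately show "card {w. (w, u) \<in> E\<^sup>+} < card {w. (w, v) \<in> E\<^sup>+}" by (rule psubset_card_mono)
qed

lemma parent_choice_no_cycle:
  assumes topo: "\<And>u v. (u, v) \<in> parcs T \<Longrightarrow> f u < (f v :: nat)"
    and single: "\<And>u u' v. (u, v) \<in> parcs T \<Longrightarrow> (u', v) \<in> parcs T \<Longrightarrow> u = u'"
    and cyc: "pre_digraph.cycle (with_proj (mk_symmetric (with_proj T))) p"
  shows "length p < 3"
proof (rule ccontr)
  assume "\<not> length p < 3"
  then have m3: "3 \<le> length p" by simp
  let ?S = "with_proj (mk_symmetric (with_proj T))"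
  from cyc obtain u where aw: "pre_digraph.awalk ?S u p u"
    and dist: "distinct (tl (pre_digraph.awalk_verts ?S u p))" and ne: "p \<noteq> []"
    by (auto simp: pre_digraph.cycle_def)
  from aw have sub: "set p \<subseteq> parcs (mk_symmetric (with_proj T))" and cas: "pre_digraph.cas ?S u p u"
    by (auto simp: pre_digraph.awalk_def)
  note w = cas_with_proj_verts[OF cas]
  define hs where "hs = map snd p"
  have dhs: "distinct hs" using dist w(1) by (simp add: hs_def)
  have len: "length hs = length p" by (simp add: hs_def)
  have fstp: "fst (p ! i) = (u # hs) ! i" if "i < length p" for i
  proof -
    have "fst (p ! i) = map fst p ! i" using that by simp
    also have "\<dots> = butlast (u # map snd p) ! i" using w(2) by simp
    also have "\<dots> = (u # map snd p) ! i" using that by (intro nth_butlast) auto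
    finally show ?thesis by (simp add: hs_def)
  qed
  \<comment> \<open>The walk is closed, so the tail of arc \<open>i\<close> is the head of its
    cyclic predecessor, also for \<open>i = 0\<close>.\<close>
  have u: "u = hs ! (length p - 1)" using w(3) ne by (simp add: hs_def last_conv_nth)
  have sndp: "snd (p ! i) = hs ! i" if "i < length p" for i using that by (simp add: hs_def)
  have heads: "fst (p ! i) \<in> set hs" if "i < length p" for i
  proof (cases i)
    case 0
    then have "fst (p ! i) = hs ! (length p - 1)" using fstp[OF that] u by simp
    then show ?thesis using nth_mem[of "length p - 1" hs] that len by (cases p) auto
  next
    case (Suc i')
    then show ?thesis using that fstp[OF that] len by simp
  qed
  have sym: "(a, b) \<in> parcs T \<or> (b, a) \<in> parcs T" if "(a, b) \<in> set p" for a b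
    using subsetD[OF sub that] by (auto simp: parcs_mk_symmetric)
  \<comment> \<open>Both neighbours on the cycle of its topologically last vertex \<open>x\<close> are the parent of \<open>x\<close>.\<close>
  obtain x where x: "x \<in> set hs" "\<And>y. y \<in> set hs \<Longrightarrow> f y \<le> f x"
  proof -
    have "finite (set hs)" "set hs \<noteq> {}" using ne by (auto simp: hs_def)
    then have "Max (f ` set hs) \<in> f ` set hs" by (intro Max_in) auto
    then obtain x where "x \<in> set hs" "f x = Max (f ` set hs)" by auto
    then show ?thesis using that[of x] by simp
  qed
  then obtain i where i: "i < length p" "hs ! i = x" using len by (auto simp: in_set_conv_nth)
  \<comment> \<open>The cyclic successor of \<open>i\<close>: arc \<open>i\<close> enters
    \<open>x\<close> and arc \<open>j\<close> leaves it.\<close>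
  define j where "j = (if Suc i < length p then Suc i else 0)"
  have j: "j < length p" using i by (auto simp: j_def)
  have pj: "fst (p ! j) = x"
  proof (cases "Suc i < length p")
    case True
    then show ?thesis using fstp[OF j] i by (simp add: j_def)
  next
    case False
    then have "i = length p - 1" using i by simp
    then show ?thesis using fstp[OF j] i u False by (simp add: j_def)
  qed
  have A: "(fst (p ! i), x) \<in> parcs T"
    using sym[of "fst (p ! i)" x] topo[of x "fst (p ! i)"] x(2)[OF heads[OF i(1)]] i sndp[OF i(1)] nth_mem[OF i(1)]
    by (metis linorder_not_less prod.collapse)
  have "hs ! j \<in> set hs" using j len by simp
  have B: "(hs ! j, x) \<in> parcs T"
    using sym[of x "hs ! j"] topo[of x "hs ! j"] x(2)[OF \<open>hs ! j \<in> set hs\<close>] sndp[OF j] nth_mem[OF j] pj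
    by (metis linorder_not_less prod.collapse)
  from single[OF A B] have eq: "(u # hs) ! i = hs ! j" using fstp[OF i(1)] by simp
  have "(u # hs) ! i = hs ! (if i = 0 then length p - 1 else i - 1)" using u by (cases i) auto
  \<comment> \<open>As the heads are distinct, the cyclic predecessor and the cyclic successor of
    \<open>i\<close> are the same index, which is impossible for three or more arcs.\<close>
  with eq have "(if i = 0 then length p - 1 else i - 1) = j"
    using nth_eq_iff_index_eq[OF dhs, of "if i = 0 then length p - 1 else i - 1" j] i j len by (auto split: if_splits)
  with m3 i show False by (auto simp: j_def split: if_splits)
qed

definition in_nbrs :: "'a rel \<Rightarrow> 'a \<Rightarrow> 'a set" where
  "in_nbrs E v = {u. (u, v) \<in> E}"

lemma acyclic_digraph_source:
  assumes "pair_digraph D" "acyclic_digraph (with_proj D)" "pverts D \<noteq> {}"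
  shows "\<exists>v \<in> pverts D. in_nbrs (parcs D) v = {}"
proof -
  interpret pair_digraph D by (rule assms(1))
  obtain f :: "_ \<Rightarrow> nat" where f: "\<And>u v. (u, v) \<in> parcs D \<Longrightarrow> f u < f v"
    using finite_acyclic_topological[OF pair_finite_arcs acyclic_digraph_imp_acyclic[OF assms(2)]] by blast
  have "Min (f ` pverts D) \<in> f ` pverts D" using pair_finite_verts assms(3) by (intro Min_in) auto
  then obtain v where v: "v \<in> pverts D" "f v = Min (f ` pverts D)" by auto
  have "(u, v) \<notin> parcs D" for u
  proof
    assume u: "(u, v) \<in> parcs D"
    then have "u \<in> pverts D" by (auto dest: arc_fst_in_verts)
    then have "f v \<le> f u" using v pair_finite_verts by simp
    with f[OF u] show False by simp
  qed
  then show ?thesis using v(1) by (auto simp: in_nbrs_def)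
qed

text \<open>The leaf set works as \<open>L\<close> because every non-root has a parent that is not a
  leaf, while a source has no in-neighbour at all. Conversely, parents chosen outside
  \<open>L\<close> keep all of \<open>L\<close> among the leaves; further leaves may arise and do no
  harm.\<close>

lemma DMLOB_iff:
  assumes D: "pair_digraph D" "acyclic_digraph (with_proj D)"
  shows "DMLOB (with_proj D) k \<longleftrightarrow>
    (\<exists>L. L \<subseteq> pverts D \<and> k \<le> card L \<and> card {v \<in> pverts D. in_nbrs (parcs D) v \<subseteq> L} = 1)"
proof
  interpret pair_digraph D by (rule D(1))
  obtain f :: "_ \<Rightarrow> nat" where f: "\<And>u v. (u, v) \<in> parcs D \<Longrightarrow> f u < f v"
    using finite_acyclic_topological[OF pair_finite_arcs acyclic_digraph_imp_acyclic[OF D(2)]] by blast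
  {
    assume "DMLOB (with_proj D) k"
    then obtain T where T: "spanning T (with_proj D)" "out_tree T" "k \<le> card (leaves T)"
      by (auto simp: DMLOB_def out_branching_def)
    from T(1) have sub: "subgraph T (with_proj D)" and V: "verts T = pverts D"
      by (auto simp: spanning_def)
    from sub have arcsT: "arcs T \<subseteq> parcs D" and comp: "tail T = fst" "head T = snd" and wf: "wf_digraph T"
      by (auto simp: subgraph_def compatible_def)
    have finT: "finite (arcs T)" using arcsT pair_finite_arcs finite_subset by blast
    obtain r where r: "r \<in> verts T" "in_degree T r = 0"
      "\<And>v. v \<in> verts T \<Longrightarrow> in_degree T v = 0 \<Longrightarrow> v = r"
      using T(2) by (auto simp: out_tree_def)
    let ?X = "{v \<in> pverts D. in_nbrs (parcs D) v \<subseteq> leaves T}"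
    have "?X \<subseteq> {r}"
    proof
      fix v assume v: "v \<in> ?X"
      show "v \<in> {r}"
      proof (rule ccontr)
        assume "v \<notin> {r}"
        with r(3) v V have "in_degree T v \<noteq> 0" by auto
        then obtain e where e: "e \<in> arcs T" "snd e = v"
          by (auto simp: in_degree_def in_arcs_def comp dest!: card_gt_0_iff[THEN iffD1])
        then have "(fst e, v) \<in> parcs D" using arcsT by auto
        with v have "fst e \<in> leaves T" by (auto simp: in_nbrs_def)
        then have "out_arcs T (fst e) = {}"
          using finT by (auto simp: leaves_def out_degree_def out_arcs_def)
        with e(1) show False unfolding out_arcs_def comp by blast
      qed
    qed
    moreover have "?X \<noteq> {}"
      using acyclic_digraph_source[OF D] r(1) V by auto
    ultimately have "?X = {r}" by blast
    then have "card ?X = 1" by simp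
    with T(3) V show "\<exists>L. L \<subseteq> pverts D \<and> k \<le> card L \<and> card {v \<in> pverts D. in_nbrs (parcs D) v \<subseteq> L} = 1"
      by (intro exI[of _ "leaves T"]) (auto simp: leaves_def)
  next
    assume "\<exists>L. L \<subseteq> pverts D \<and> k \<le> card L \<and> card {v \<in> pverts D. in_nbrs (parcs D) v \<subseteq> L} = 1"
    then obtain L r where L: "L \<subseteq> pverts D" "k \<le> card L"
      and r: "{v \<in> pverts D. in_nbrs (parcs D) v \<subseteq> L} = {r}" by (auto simp: card_1_singleton_iff)
    have "\<exists>u. (u, v) \<in> parcs D \<and> u \<notin> L" if "v \<in> pverts D" "v \<noteq> r" for v
      using r that by (auto simp: in_nbrs_def)
    then obtain par where par: "\<And>v. v \<in> pverts D \<Longrightarrow> v \<noteq> r \<Longrightarrow> (par v, v) \<in> parcs D \<and> par v \<notin> L"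
      by metis
    define T where "T = \<lparr> pverts = pverts D, parcs = (\<lambda>v. (par v, v)) ` (pverts D - {r}) \<rparr>"
    have rD: "r \<in> pverts D" using r by auto
    have sub: "parcs T \<subseteq> parcs D" using par by (auto simp: T_def)
    have VT: "pverts T = pverts D" by (simp add: T_def)
    have PT: "pair_digraph T"
    proof
      show "fst e \<in> pverts T" "snd e \<in> pverts T" "fst e \<noteq> snd e" if "e \<in> parcs T" for e
        using subsetD[OF sub that] arc_fst_in_verts arc_snd_in_verts pair_no_loops VT by simp_all
      show "finite (pverts T)" using pair_finite_verts VT by simp
      show "finite (parcs T)" using sub pair_finite_arcs by (rule finite_subset)
    qed
    interpret T: pair_digraph T by (rule PT)
    interpret S: pair_digraph "mk_symmetric (with_proj T)" ..
    have single: "u = u'" if "(u, v) \<in> parcs T" "(u', v) \<in> parcs T" for u u' v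
      using that by (auto simp: T_def)
    have fT: "f u < f v" if "(u, v) \<in> parcs T" for u v using that sub f by auto
    have noopp: "(v, u) \<notin> parcs T" if "(u, v) \<in> parcs T" for u v using fT[OF that] fT[of v u] by auto
    \<comment> \<open>Parents have smaller values of \<open>f\<close>, so following them upwards
      ends, and it can end only at \<open>r\<close>.\<close>
    have reach: "r \<rightarrow>\<^sup>*\<^bsub>with_proj T\<^esub> v" if "v \<in> pverts D" for v
      using that
    proof (induction "f v" arbitrary: v rule: less_induct)
      case less
      show ?case
      proof (cases "v = r")
        case True
        then show ?thesis using rD VT by simp
      next
        case False
        then have arc: "(par v, v) \<in> parcs T" using less.prems by (auto simp: T_def)
        then have "par v \<in> pverts D" using VT T.in_arcsD1 by simp
        with less.hyps[OF fT[OF arc]] have "r \<rightarrow>\<^sup>*\<^bsub>with_proj T\<^esub> par v" by simp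
        then show ?thesis using arc by (rule T.reachable_adj_trans)
      qed
    qed
    have conn: "connected (with_proj T)"
      unfolding connected_def strongly_connected_def
    proof (intro conjI ballI)
      show "verts (with_proj (mk_symmetric (with_proj T))) \<noteq> {}" using rD VT by auto
      fix u v
      assume "u \<in> verts (with_proj (mk_symmetric (with_proj T)))"
        "v \<in> verts (with_proj (mk_symmetric (with_proj T)))"
      then have "u \<in> pverts D" "v \<in> pverts D" using VT by auto
      then have "r \<rightarrow>\<^sup>*\<^bsub>mk_symmetric (with_proj T)\<^esub> u" "r \<rightarrow>\<^sup>*\<^bsub>mk_symmetric (with_proj T)\<^esub> v"
        using reach T.reachable_mk_symmetricI by auto
      then show "u \<rightarrow>\<^sup>*\<^bsub>mk_symmetric (with_proj T)\<^esub> v"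
        by (rule S.reachable_trans[OF symmetric_reachable[OF symmetric_mk_symmetric]])
    qed
    have indeg: "in_degree (with_proj T) v = 0 \<longleftrightarrow> v = r" if "v \<in> pverts D" for v
    proof -
      have "in_arcs (with_proj T) v = (if v = r then {} else {(par v, v)})"
        using that by (auto simp: in_arcs_def T_def)
      then show ?thesis by (simp add: in_degree_def)
    qed
    have "oriented_tree (with_proj T)"
      unfolding oriented_tree_def
    proof (intro conjI allI impI)
      show "digraph (with_proj T)" ..
      show "\<not> v \<rightarrow>\<^bsub>with_proj T\<^esub> u" if "u \<rightarrow>\<^bsub>with_proj T\<^esub> v" for u v
        using that noopp by (auto simp: arcs_ends_def arc_to_ends_def)
      show "connected (with_proj T)" by (rule conn)
      show "\<not> (\<exists>p. pre_digraph.cycle (with_proj (mk_symmetric (with_proj T))) p \<and> 3 \<le> length p)"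
      proof (intro notI, elim exE conjE)
        fix p assume "pre_digraph.cycle (with_proj (mk_symmetric (with_proj T))) p" "3 \<le> length p"
        moreover have "length p < 3" if "pre_digraph.cycle (with_proj (mk_symmetric (with_proj T))) p"
          using fT single that by (rule parent_choice_no_cycle)
        ultimately show False by simp
      qed
    qed
    moreover have "\<exists>!r. r \<in> verts (with_proj T) \<and> in_degree (with_proj T) r = 0"
    proof (rule ex1I)
      show "r \<in> verts (with_proj T) \<and> in_degree (with_proj T) r = 0" using rD VT indeg by simp
      show "x = r" if "x \<in> verts (with_proj T) \<and> in_degree (with_proj T) x = 0" for x
        using that indeg[of x] VT by simp
    qed
    ultimately have "out_tree (with_proj T)" by (simp add: out_tree_def)
    moreover have "spanning (with_proj T) (with_proj D)"
      unfolding spanning_def subgraph_def compatible_def using sub VT wf_digraph T.wf_digraph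
      by simp
    ultimately have ob: "out_branching (with_proj T) (with_proj D)" by (simp add: out_branching_def)
    have "L \<subseteq> leaves (with_proj T)"
    proof
      fix x assume "x \<in> L"
      then have "out_arcs (with_proj T) x = {}" using par by (auto simp: out_arcs_def T_def)
      then have "out_degree (with_proj T) x = 0" by (simp add: out_degree_def)
      with \<open>x \<in> L\<close> L(1) VT show "x \<in> leaves (with_proj T)"
        unfolding leaves_def by auto
    qed
    moreover have "finite (leaves (with_proj T))" using VT pair_finite_verts by (simp add: leaves_def)
    ultimately have "card L \<le> card (leaves (with_proj T))" by (intro card_mono)
    then have "k \<le> card (leaves (with_proj T))" using L(2) by simp
    with ob show "DMLOB (with_proj D) k" unfolding DMLOB_def by (intro exI conjI)
  }
qed

section \<open>Sole in-neighbours\<close>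

text \<open>The weights balance a greedy procedure: a vertex removed from \<open>V\<close> costs 2,
  a selected vertex pays 3 and an edge that is settled pays 1. Discarding a vertex of two edges
  gives 2 for 2; selecting one vertex and discarding another from its only edge gives 4 for 3 +
  1.\<close>

lemma hypergraph_independent_set:
  assumes "finite V" "finite F" "\<And>e. e \<in> F \<Longrightarrow> 2 \<le> card (S e)"
  shows "\<exists>I \<subseteq> V. 2 * card V \<le> 3 * card I + card F \<and> (\<forall>e \<in> F. \<not> S e \<subseteq> I)"
  using assms
proof (induction "card V" arbitrary: V F rule: less_induct)
  \<comment> \<open>Discard a vertex lying in two edges. If there is none, select any vertex, which costs at most one
    further vertex, discarded from the only edge that contains the selected one.\<close>
  case less
  have smaller: "card (V - W) < card V" if "v \<in> V" "v \<in> W" for v W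
    using that less.prems(1) by (intro psubset_card_mono) auto
  consider "V = {}" | v where "v \<in> V" "2 \<le> card {e \<in> F. v \<in> S e}"
    | v where "v \<in> V" "card {e \<in> F. v \<in> S e} = 0" | v where "v \<in> V" "card {e \<in> F. v \<in> S e} = 1"
  proof (cases "V = {}")
    case False
    then obtain v where "v \<in> V" by auto
    then show ?thesis using that(2-4)[of v] by linarith
  qed (rule that(1))
  then show ?case
  proof cases
    case 1
    with less.prems(3) show ?thesis by fastforce
  next
    case (2 v)
    let ?F = "F - {e \<in> F. v \<in> S e}"
    obtain I where I: "I \<subseteq> V - {v}" "2 * card (V - {v}) \<le> 3 * card I + card ?F" "\<forall>e \<in> ?F. \<not> S e \<subseteq> I"
      using less.hyps[OF smaller, of v "{v}" ?F] 2 less.prems by auto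
    have "card ?F = card F - card {e \<in> F. v \<in> S e}" "card {e \<in> F. v \<in> S e} \<le> card F"
      using less.prems by (auto intro!: card_Diff_subset card_mono)
    moreover have "card (V - {v}) = card V - 1" using 2 less.prems by simp
    ultimately have "2 * card V \<le> 3 * card I + card F" using I(2) 2 by linarith
    with I 2 show ?thesis by (intro exI[of _ I]) blast
  next
    case (3 v)
    then have none: "v \<notin> S e" if "e \<in> F" for e using that less.prems(2) by auto
    obtain I where I: "I \<subseteq> V - {v}" "2 * card (V - {v}) \<le> 3 * card I + card F" "\<forall>e \<in> F. \<not> S e \<subseteq> I"
      using less.hyps[OF smaller, of v "{v}" F] 3 less.prems by auto
    have "finite I" using I(1) less.prems(1) finite_subset by blast
    then have "card (insert v I) = Suc (card I)" using I(1) by (intro card_insert_disjoint) auto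
    moreover have "card (V - {v}) = card V - 1" using 3 less.prems by simp
    ultimately have "2 * card V \<le> 3 * card (insert v I) + card F" using I(2) by linarith
    with I 3 none show ?thesis by (intro exI[of _ "insert v I"]) blast
  next
    case (4 v)
    then obtain e0 where e0: "{e \<in> F. v \<in> S e} = {e0}" by (auto simp: card_1_singleton_iff)
    then have e0F: "e0 \<in> F" "v \<in> S e0" by auto
    have "\<not> S e0 \<subseteq> {v}" using less.prems(3)[OF e0F(1)] card_mono[of "{v}" "S e0"] by auto
    then obtain w where w: "w \<in> S e0" "w \<noteq> v" by auto
    let ?F = "F - {e0}"
    obtain I where I: "I \<subseteq> V - {v, w}" "2 * card (V - {v, w}) \<le> 3 * card I + card ?F" "\<forall>e \<in> ?F. \<not> S e \<subseteq> I"
      using less.hyps[OF smaller, of v "{v, w}" ?F] 4 less.prems by auto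
    have "finite I" using I(1) less.prems(1) finite_subset by blast
    then have "card (insert v I) = Suc (card I)" using I(1) by (intro card_insert_disjoint) auto
    \<comment> \<open>Only an inequality, since the edge \<open>S e0\<close> may reach outside
      \<open>V\<close> and \<open>w\<close> may lie there.\<close>
    moreover have "card V \<le> card (V - {v, w}) + 2"
      using diff_card_le_card_Diff[of "{v, w}" V] w by simp
    moreover have "card ?F = card F - 1" "1 \<le> card F" using e0F less.prems(2)
      by (auto simp: Suc_le_eq card_gt_0_iff)
    ultimately have "2 * card V \<le> 3 * card (insert v I) + card F" using I(2) by linarith
    moreover have "\<not> S e \<subseteq> insert v I" if "e \<in> F" for e
    proof (cases "e = e0")
      case True
      then show ?thesis using w I(1) by auto
    next
      case False
      then show ?thesis using that e0 I(3) by blast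
    qed
    ultimately show ?thesis using I(1) 4 by (intro exI[of _ "insert v I"]) blast
  qed
qed

section \<open>Vertices that may become leaves\<close>

definition free_verts :: "'a rel \<Rightarrow> 'a set \<Rightarrow> 'a set" where
  "free_verts E V = {u \<in> V. \<forall>v \<in> V. in_nbrs E v \<noteq> {u}}"

text \<open>Three disjoint kinds of vertices are counted within \<open>V\<close>: one private vertex
  \<open>w u\<close> for each \<open>u\<close> outside \<open>?C\<close>, the source, and the
  vertices in \<open>?F\<close>. Hence \<open>?F\<close> has fewer members than \<open>?C\<close>,
  and the independent set of the hypergraph lemma can be used as \<open>L\<close>.\<close>

lemma many_free_verts:
  assumes fin: "finite V" and src: "card {v \<in> V. in_nbrs E v = {}} = 1" and k: "3 * k \<le> card (free_verts E V)"
    and E: "E \<subseteq> V \<times> V"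
  shows "\<exists>L \<subseteq> V. k \<le> card L \<and> card {v \<in> V. in_nbrs E v \<subseteq> L} = 1"
proof -
  let ?C = "free_verts E V"
  let ?F = "{v \<in> V. in_nbrs E v \<subseteq> ?C \<and> 2 \<le> card (in_nbrs E v)}"
  have CV: "?C \<subseteq> V" by (auto simp: free_verts_def)
  obtain r where r: "{v \<in> V. in_nbrs E v = {}} = {r}" using src by (auto simp: card_1_singleton_iff)
  have "\<forall>u \<in> V - ?C. \<exists>v \<in> V. in_nbrs E v = {u}" by (auto simp: free_verts_def)
  then obtain w where w: "\<And>u. u \<in> V - ?C \<Longrightarrow> w u \<in> V \<and> in_nbrs E (w u) = {u}" by metis
  \<comment> \<open>The in-neighbourhood \<open>{u}\<close> of \<open>w u\<close> determines
    \<open>u\<close>.\<close>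
  have "inj_on w (V - ?C)" by (rule inj_onI) (metis w singleton_inject)
  then have "card (w ` (V - ?C)) = card V - card ?C"
    using fin CV by (simp add: card_image card_Diff_subset finite_subset)
  moreover have "w u \<notin> insert r ?F" if "u \<in> V - ?C" for u
  proof -
    have "in_nbrs E r = {}" using r by auto
    with w[OF that] show ?thesis by auto
  qed
  then have "card (w ` (V - ?C) \<union> insert r ?F) = card (w ` (V - ?C)) + card (insert r ?F)"
    using fin by (intro card_Un_disjoint) auto
  moreover have "in_nbrs E r = {}" using r by auto
  then have "r \<notin> ?F" by auto
  then have "card (insert r ?F) = Suc (card ?F)" using fin by simp
  moreover have "card (w ` (V - ?C) \<union> insert r ?F) \<le> card V"
    using w r fin by (intro card_mono) auto
  moreover have "card ?C \<le> card V" using fin CV by (rule card_mono)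
  ultimately have F: "card ?F < card ?C" by linarith
  have "\<exists>I \<subseteq> ?C. 2 * card ?C \<le> 3 * card I + card ?F \<and> (\<forall>v \<in> ?F. \<not> in_nbrs E v \<subseteq> I)"
    by (rule hypergraph_independent_set) (use finite_subset[OF CV fin] fin in auto)
  then obtain I where I: "I \<subseteq> ?C" "2 * card ?C \<le> 3 * card I + card ?F" "\<forall>v \<in> ?F. \<not> in_nbrs E v \<subseteq> I"
    by blast
  \<comment> \<open>From \<open>2 * card ?C \<le> 3 * card I + card ?F\<close> and
    \<open>card ?F < card ?C\<close> follows
    \<open>3 * k \<le> card ?C < 3 * card I\<close>.\<close>
  have "k \<le> card I" using I(2) F k by linarith
  moreover have "{v \<in> V. in_nbrs E v \<subseteq> I} = {r}"
  proof -
    \<comment> \<open>A singleton in-neighbourhood would consist of a vertex outside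
      \<open>?C\<close>, and a larger one would be an edge in \<open>?F\<close>, which
      \<open>I\<close> does not contain.\<close>
    have "in_nbrs E v = {}" if v: "v \<in> V" "in_nbrs E v \<subseteq> I" for v
    proof (rule ccontr)
      assume ne: "in_nbrs E v \<noteq> {}"
      have "finite (in_nbrs E v)" using v I(1) CV fin by (meson finite_subset)
      then have "card (in_nbrs E v) \<noteq> 0" using ne by simp
      moreover have "card (in_nbrs E v) \<noteq> 1"
      proof
        assume "card (in_nbrs E v) = 1"
        then obtain u where u: "in_nbrs E v = {u}" by (auto simp: card_1_singleton_iff)
        then have "u \<in> ?C" using v(2) I(1) by auto
        with u v(1) show False by (simp add: free_verts_def)
      qed
      ultimately have "v \<in> ?F" using v I(1) by auto
      with I(3) v show False by blast
    qed
    then have "{v \<in> V. in_nbrs E v \<subseteq> I} = {v \<in> V. in_nbrs E v = {}}" by auto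
    then show ?thesis using r by (rule trans)
  qed
  then have "card {v \<in> V. in_nbrs E v \<subseteq> I} = 1" by simp
  moreover have "I \<subseteq> V" using I(1) CV by (rule subset_trans)
  ultimately show ?thesis by (intro exI[of _ I] conjI)
qed

text \<open>A suitable \<open>L\<close> captures some source, which is therefore the only captured
  vertex and the only source; a sole in-neighbour in \<open>L\<close> would capture a second vertex.
  Sources are written as \<open>in_nbrs E v \<subseteq> {}\<close> so that the machine can count
  them with the same routine that tests \<open>L\<close>.\<close>

lemma DMLOB_decision:
  assumes D: "pair_digraph D" "acyclic_digraph (with_proj D)"
  defines "V \<equiv> pverts D" and "E \<equiv> parcs D"
  shows "DMLOB (with_proj D) k \<longleftrightarrow>
    (if 3 * k \<le> card (free_verts E V) then card {v \<in> V. in_nbrs E v \<subseteq> {}} = 1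
     else \<exists>L \<subseteq> free_verts E V. k \<le> card L \<and> card {v \<in> V. in_nbrs E v \<subseteq> L} = 1)"
proof -
  interpret pair_digraph D by (rule D(1))
  have fin: "finite V" using pair_finite_verts by (simp add: V_def)
  have EV: "E \<subseteq> V \<times> V" unfolding E_def V_def using in_arcsD1 in_arcsD2 by auto
  have CV: "free_verts E V \<subseteq> V" by (auto simp: free_verts_def)
  have *: "card {v \<in> V. in_nbrs E v \<subseteq> {}} = 1 \<and> L \<subseteq> free_verts E V"
    if L: "L \<subseteq> V" "card {v \<in> V. in_nbrs E v \<subseteq> L} = 1" for L
  proof -
    obtain r where r: "{v \<in> V. in_nbrs E v \<subseteq> L} = {r}" using L(2) by (auto simp: card_1_singleton_iff)
    then have "r \<in> V" by auto
    then obtain s where s: "s \<in> V" "in_nbrs E s = {}"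
      using acyclic_digraph_source[OF D] by (auto simp: E_def V_def)
    then have "s \<in> {v \<in> V. in_nbrs E v \<subseteq> L}" by auto
    then have "s = r" using r by auto
    moreover have "in_nbrs E v \<subseteq> L \<Longrightarrow> v \<in> V \<Longrightarrow> v = r" for v using r by auto
    ultimately have "{v \<in> V. in_nbrs E v \<subseteq> {}} = {r}" using s by auto
    moreover have "L \<subseteq> free_verts E V"
    proof
      fix u assume "u \<in> L"
      have "in_nbrs E v \<noteq> {u}" if "v \<in> V" for v
        using \<open>u \<in> L\<close> that s \<open>s = r\<close> \<open>\<And>v. in_nbrs E v \<subseteq> L \<Longrightarrow> v \<in> V \<Longrightarrow> v = r\<close>[of v] by auto
      then show "u \<in> free_verts E V" using \<open>u \<in> L\<close> L(1) by (auto simp: free_verts_def)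
    qed
    ultimately show ?thesis by simp
  qed
  show ?thesis
  proof (cases "3 * k \<le> card (free_verts E V)")
    case True
    have "DMLOB (with_proj D) k \<longleftrightarrow> card {v \<in> V. in_nbrs E v \<subseteq> {}} = 1"
      using many_free_verts[OF fin _ True EV] * unfolding DMLOB_iff[OF D] V_def E_def by auto
    with True show ?thesis by simp
  next
    case False
    have "DMLOB (with_proj D) k \<longleftrightarrow> (\<exists>L \<subseteq> free_verts E V. k \<le> card L \<and> card {v \<in> V. in_nbrs E v \<subseteq> L} = 1)"
      using * CV unfolding DMLOB_iff[OF D] V_def E_def by (meson subset_trans)
    with False show ?thesis by simp
  qed
qed

section \<open>Weakest preconditions\<close>

text \<open>A total-correctness precondition: it asserts a halting run, unique by determinism, whose
  running time is passed on to \<open>Q\<close>.\<close>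

definition wp :: "com \<Rightarrow> (nat \<Rightarrow> nat) \<Rightarrow> (nat \<Rightarrow> nat) \<Rightarrow> (nat \<Rightarrow> (nat \<Rightarrow> nat) \<Rightarrow> (nat \<Rightarrow> nat) \<Rightarrow> bool) \<Rightarrow> bool" where
  "wp c R M Q \<longleftrightarrow> (\<exists>t R' M'. exec c (R, M) t (R', M') \<and> Q t R' M')"

lemma wp_basic [simp]:
  "wp (LIT i a) R M Q \<longleftrightarrow> Q 1 (R(i := a)) M"
  "wp (ADD i j l) R M Q \<longleftrightarrow> Q 1 (R(i := R j + R l)) M"
  "wp (SUB i j l) R M Q \<longleftrightarrow> Q 1 (R(i := R j - R l)) M"
  "wp (LOAD i j) R M Q \<longleftrightarrow> Q 1 (R(i := M (R j))) M"
  "wp (STORE i j) R M Q \<longleftrightarrow> Q 1 R (M(R i := R j))"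
  unfolding wp_def by (fastforce intro: exec.intros elim: exec_elims)+

lemma wp_SEQ [simp]: "wp (SEQ c1 c2) R M Q \<longleftrightarrow> wp c1 R M (\<lambda>t R' M'. wp c2 R' M' (\<lambda>t'. Q (t + t')))"
  unfolding wp_def by (fastforce intro: exec.Seq elim: exec_elims)

lemma wp_IFNZ [simp]:
  "wp (IFNZ i c1 c2) R M Q \<longleftrightarrow> (if R i \<noteq> 0 then wp c1 R M (\<lambda>t. Q (t + 1)) else wp c2 R M (\<lambda>t. Q (t + 1)))"
proof -
  have "exec (IFNZ i c1 c2) (R, M) t s \<longleftrightarrow> (\<exists>t'. t = t' + 1 \<and> exec (if R i \<noteq> 0 then c1 else c2) (R, M) t' s)" for t s
    by (auto intro: exec.IfTrue[simplified] exec.IfFalse[simplified] elim: exec_elims(7))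
  then show ?thesis unfolding wp_def by auto
qed

lemma wp_mono:
  assumes "wp c R M P" "\<And>t R' M'. P t R' M' \<Longrightarrow> Q t R' M'"
  shows "wp c R M Q"
  using assms unfolding wp_def by blast

text \<open>The language has no empty command; a write to a scratch register stands in for it and
  costs one unit.\<close>

fun seqs :: "com list \<Rightarrow> com" where
  "seqs [] = LIT 13 0"
| "seqs [c] = c"
| "seqs (c # cs) = SEQ c (seqs cs)"

text \<open>Throughout the program, register 2 holds 1, register 31 holds 0, and register 13 is scratch.\<close>

definition MOV :: "nat \<Rightarrow> nat \<Rightarrow> com" where "MOV i j = ADD i j 31"

definition FOR :: "nat \<Rightarrow> com \<Rightarrow> com" where "FOR i c = WHILENZ i (SEQ c (SUB i i 2))"

lemma wp_MOV [simp]: "wp (MOV i j) R M Q \<longleftrightarrow> Q 1 (R(i := R j + R 31)) M"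
  by (simp add: MOV_def)

text \<open>The counter runs down while \<open>j\<close>, the number of finished rounds, runs up;
  the invariant is required after the decrement, which relies on register 2 holding 1. Each round
  costs \<open>B\<close> plus the decrement and the test, and the final 1 is the failing
  test.\<close>

lemma wp_FOR:
  assumes step: "\<And>j R M. j < N \<Longrightarrow> I j R M \<Longrightarrow> R i = N - j \<Longrightarrow>
      wp c R M (\<lambda>t R' M'. t \<le> B \<and> R' i = N - j \<and> R' 2 = 1 \<and> I (Suc j) (R'(i := N - Suc j)) M')"
    and init: "I 0 R M" "R i = N"
  shows "wp (FOR i c) R M (\<lambda>t R' M'. t \<le> N * (B + 2) + 1 \<and> R' i = 0 \<and> I N R' M')"
proof -
  have "wp (FOR i c) R M (\<lambda>t R' M'. t \<le> (N - j) * (B + 2) + 1 \<and> R' i = 0 \<and> I N R' M')"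
    if "j \<le> N" "I j R M" "R i = N - j" for j R M
    using that
  proof (induction "N - j" arbitrary: j R M)
    case 0
    then have "j = N" "R i = 0" by auto
    then have "exec (FOR i c) (R, M) 1 (R, M)" unfolding FOR_def by (intro exec.WhileFalse)
    then show ?case using 0 \<open>j = N\<close> \<open>R i = 0\<close> unfolding wp_def by (intro exI[of _ 1] exI[of _ R] exI[of _ M]) auto
  next
    case (Suc d)
    then have j: "j < N" "d = N - Suc j" by auto
    from step[OF j(1) Suc.prems(2,3)] obtain t R' M' where
      b: "exec c (R, M) t (R', M')" "t \<le> B" "R' i = N - j" "R' 2 = 1" "I (Suc j) (R'(i := N - Suc j)) M'"
      unfolding wp_def by blast
    have "exec (SUB i i 2) (R', M') 1 (R'(i := N - Suc j), M')"
      using exec.Sub[of i i 2 R' M'] b by (simp add: Suc_diff_Suc)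
    with b(1) have body: "exec (SEQ c (SUB i i 2)) (R, M) (t + 1) (R'(i := N - Suc j), M')" by (rule exec.Seq)
    from Suc.hyps(1)[OF j(2) _ b(5)] j obtain u R'' M'' where
      w: "exec (FOR i c) (R'(i := N - Suc j), M') u (R'', M'')" "u \<le> d * (B + 2) + 1" "R'' i = 0" "I N R'' M''"
      unfolding wp_def by auto
    have "exec (FOR i c) (R, M) (t + 1 + u + 1) (R'', M'')"
      using exec.WhileTrue[OF _ body w(1)[unfolded FOR_def]] Suc.prems(3) j by (simp add: FOR_def)
    moreover have "t + 1 + u + 1 \<le> (N - j) * (B + 2) + 1" using w(2) b(2) Suc.hyps(2)[symmetric] by simp
    ultimately show ?case unfolding wp_def using w(3,4) by blast
  qed
  from this[of 0] init show ?thesis by simp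
qed

text \<open>A frame condition: \<open>X\<close> bounds the registers that may have been
  overwritten.\<close>

definition agree :: "nat set \<Rightarrow> (nat \<Rightarrow> nat) \<Rightarrow> (nat \<Rightarrow> nat) \<Rightarrow> bool" where
  "agree X R R' \<longleftrightarrow> (\<forall>r. r \<notin> X \<longrightarrow> R' r = R r)"

lemma agree_upd [simp]: "i \<in> X \<Longrightarrow> agree X R (R'(i := a)) \<longleftrightarrow> agree X R R'"
  by (auto simp: agree_def)

lemma agree_refl [simp]: "agree X R R"
  by (simp add: agree_def)

lemma agreeD: "agree X R R' \<Longrightarrow> r \<notin> X \<Longrightarrow> R' r = R r"
  by (simp add: agree_def)

lemma agree_trans: "agree X R R' \<Longrightarrow> agree Y R' R'' \<Longrightarrow> X \<subseteq> Z \<Longrightarrow> Y \<subseteq> Z \<Longrightarrow> agree Z R R''"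
  unfolding agree_def by (metis subsetD)

section \<open>Scanning the adjacency matrix\<close>

text \<open>The memory behind the adjacency matrix holds two arrays of flags, for vertex sets \<open>B\<close> and
  \<open>L\<close>; registers 4 and 5 hold their addresses.\<close>

definition base_regs :: "nat \<Rightarrow> (nat \<Rightarrow> nat) \<Rightarrow> bool" where
  "base_regs n R \<longleftrightarrow> R 0 = n \<and> R 2 = 1 \<and> R 4 = n * n \<and> R 5 = n * n + n \<and> R 31 = 0"

definition graph_mem :: "nat \<Rightarrow> nat rel \<Rightarrow> nat set \<Rightarrow> nat set \<Rightarrow> (nat \<Rightarrow> nat) \<Rightarrow> bool" where
  "graph_mem n E B L M \<longleftrightarrow>
     (\<forall>u<n. \<forall>v<n. M (u * n + v) = of_bool ((u, v) \<in> E)) \<and>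
     (\<forall>u<n. M (n * n + u) = of_bool (u \<in> B)) \<and>
     (\<forall>u<n. M (n * n + n + u) = of_bool (u \<in> L))"

text \<open>Separates the matrix from the flag arrays behind it, so that writing a flag leaves the
  matrix intact.\<close>

lemma matrix_index_less: "u < n \<Longrightarrow> v < n \<Longrightarrow> u * n + v < n * (n :: nat)"
  by (metis add_less_cancel_left less_le_trans mult.commute mult_Suc mult_le_mono1 Suc_leI add.commute)

lemma mem_mark:
  assumes "graph_mem n E B L M" "u < n"
  shows "graph_mem n E (insert u B) L (M(n * n + u := 1))"
proof -
  have "a * n + b \<noteq> n * n + u" if "a < n" "b < n" for a b
    using matrix_index_less[OF that] by linarith
  then show ?thesis using assms by (auto simp: graph_mem_def)
qed

lemma mem_set_flag:
  assumes "graph_mem n E B L M" "u < n" "\<And>w. w < n \<Longrightarrow> w \<noteq> u \<Longrightarrow> w \<in> L' \<longleftrightarrow> w \<in> L" "a = of_bool (u \<in> L')"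
  shows "graph_mem n E B L' (M(n * n + n + u := a))"
proof -
  have "a * n + b \<noteq> n * n + n + u" if "a < n" "b < n" for a b
    using matrix_index_less[OF that] by linarith
  then show ?thesis using assms by (auto simp: graph_mem_def)
qed

lemma mem_cong: "graph_mem n E B L M \<Longrightarrow> (\<And>u. u < n \<Longrightarrow> u \<in> B' \<longleftrightarrow> u \<in> B) \<Longrightarrow>
  (\<And>u. u < n \<Longrightarrow> u \<in> L' \<longleftrightarrow> u \<in> L) \<Longrightarrow> graph_mem n E B' L' M"
  by (simp add: graph_mem_def)

lemma card_less_Suc: "card {u. u < Suc j \<and> P u} = card {u. u < j \<and> P u} + of_bool (P j)"
proof -
  have "{u. u < Suc j \<and> P u} = (if P j then insert j {u. u < j \<and> P u} else {u. u < j \<and> P u})"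
    by (auto simp: less_Suc_eq)
  then show ?thesis by simp
qed

abbreviation "scan_regs \<equiv> {8, 9, 10, 11, 12, 13, 24, 26 :: nat}"

text \<open>Register 6 holds the column \<open>v\<close>. The scan counts the in-neighbours of \<open>v\<close> outside
  \<open>L\<close> in register 10 and leaves the address of the \<open>B\<close>-flag of the last one in register 11.\<close>

definition scan_body :: com where
  "scan_body = seqs [LOAD 13 8, LOAD 26 24, SUB 13 13 26,
     IFNZ 13 (seqs [ADD 10 10 2, MOV 11 9]) (seqs []), ADD 8 8 0, ADD 9 9 2, ADD 24 24 2]"

definition scan :: com where
  "scan = seqs [MOV 8 6, MOV 9 4, MOV 24 5, LIT 10 0, MOV 12 0, FOR 12 scan_body]"

lemma wp_scan:
  assumes R: "base_regs n R" "R 6 = v" and M: "graph_mem n E B L M" and v: "v < n" and E: "E \<subseteq> {..<n} \<times> {..<n}"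
  shows "wp scan R M (\<lambda>t R' M'. t \<le> 20 * (n + 1) \<and> M' = M \<and> agree scan_regs R R' \<and>
    R' 10 = card (in_nbrs E v - L) \<and> (R' 10 \<noteq> 0 \<longrightarrow> (\<exists>u \<in> in_nbrs E v - L. R' 11 = n * n + u)))"
proof -
  define Q where "Q u \<longleftrightarrow> (u, v) \<in> E \<and> u \<notin> L" for u
  define I where "I j R' M' \<longleftrightarrow> M' = M \<and> agree scan_regs R R' \<and> R' 8 = j * n + v \<and> R' 9 = n * n + j \<and>
    R' 24 = n * n + n + j \<and> R' 10 = card {u. u < j \<and> Q u} \<and>
    (R' 10 \<noteq> 0 \<longrightarrow> (\<exists>u<j. Q u \<and> R' 11 = n * n + u))" for j R' M'
  have loop: "wp (FOR 12 scan_body) R1 M (\<lambda>t R' M'. t \<le> n * (10 + 2) + 1 \<and> R' 12 = 0 \<and> I n R' M')"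
    if "I 0 R1 M" "R1 12 = n" for R1
  proof (rule wp_FOR[where I = I, OF _ that])
    fix j R' M'
    assume j: "j < n" and I: "I j R' M'" and c: "R' 12 = n - j"
    from I have M': "M' = M" and ag: "agree scan_regs R R'" by (auto simp: I_def)
    have r: "R' 0 = n" "R' 2 = 1" "R' 31 = 0" using agreeD[OF ag] R by (auto simp: base_regs_def)
    have m: "M (j * n + v) = of_bool ((j, v) \<in> E)" "M (n * n + n + j) = of_bool (j \<in> L)"
      using M j v by (auto simp: graph_mem_def)
    show "wp scan_body R' M' (\<lambda>t R' M'. t \<le> 10 \<and> R' 12 = n - j \<and> R' 2 = 1 \<and> I (Suc j) (R'(12 := n - Suc j)) M')"
    proof (cases "Q j")
      case True
      \<comment> \<open>Entry minus \<open>L\<close>-flag is a truncated difference of two bits, and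
        so the truth value of \<open>Q j\<close>.\<close>
      then have d: "M (j * n + v) - M (n * n + n + j) = 1" using m by (simp add: Q_def)
      then show ?thesis using I c r True
        by (simp add: scan_body_def I_def M' card_less_Suc)
    next
      case False
      then have d: "M (j * n + v) - M (n * n + n + j) = 0" using m by (simp add: Q_def)
      then show ?thesis using I c r False
        by (simp add: scan_body_def I_def M' card_less_Suc) (metis less_SucI)
    qed
  qed
  have nb: "in_nbrs E v - L = {u. u < n \<and> Q u}" using E by (auto simp: in_nbrs_def Q_def)
  show ?thesis
    unfolding scan_def seqs.simps wp_SEQ wp_basic wp_MOV
  proof (rule wp_mono[OF loop], goal_cases)
    case 1
    then show ?case using R by (simp add: base_regs_def I_def)
  next
    case 2
    then show ?case using R by (simp add: base_regs_def)
  next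
    case (3 t R' M')
    then have t: "t \<le> n * (10 + 2) + 1" and I: "I n R' M'" by simp_all
    show ?case unfolding nb
    proof (intro conjI)
      show "1 + (1 + (1 + (1 + (1 + t)))) \<le> 20 * (n + 1)" using t by simp
      show "M' = M" "agree scan_regs R R'" "R' 10 = card {u. u < n \<and> Q u}"
        using I by (simp_all only: I_def)
      show "R' 10 \<noteq> 0 \<longrightarrow> (\<exists>u \<in> {u. u < n \<and> Q u}. R' 11 = n * n + u)"
        using I unfolding I_def by blast
    qed
  qed
qed

section \<open>Traversing all columns\<close>

abbreviation "column_regs \<equiv> {6, 7, 25 :: nat} \<union> scan_regs"

definition columns_body :: "com \<Rightarrow> com" where
  "columns_body c = seqs [scan, IFNZ 10 c (ADD 25 25 2), ADD 6 6 2]"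

definition columns :: "com \<Rightarrow> com" where
  "columns c = seqs [LIT 25 0, LIT 6 0, MOV 7 0, FOR 7 (columns_body c)]"

text \<open>\<open>B j\<close> is the set of \<open>B\<close>-flags after \<open>j\<close> columns.
  Leaving \<open>c\<close> and \<open>B\<close> open lets one traversal serve two purposes: marking
  the sole in-neighbours, and merely counting the vertices captured by \<open>L\<close>.\<close>

lemma wp_columns:
  assumes R: "base_regs n R" and M: "graph_mem n E (B 0) L M" and E: "E \<subseteq> {..<n} \<times> {..<n}"
    and body: "\<And>j R M. j < n \<Longrightarrow> base_regs n R \<Longrightarrow> graph_mem n E (B j) L M \<Longrightarrow> R 10 = card (in_nbrs E j - L) \<Longrightarrow>
      \<exists>u \<in> in_nbrs E j - L. R 11 = n * n + u \<Longrightarrow>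
      wp c R M (\<lambda>t R' M'. t \<le> 10 \<and> agree {13} R R' \<and> graph_mem n E (B (Suc j)) L M')"
    and skip: "\<And>j. j < n \<Longrightarrow> in_nbrs E j \<subseteq> L \<Longrightarrow> B (Suc j) = B j"
  shows "wp (columns c) R M (\<lambda>t R' M'. t \<le> 40 * ((n + 1) * (n + 1)) \<and> agree column_regs R R' \<and>
    graph_mem n E (B n) L M' \<and> R' 25 = card {v. v < n \<and> in_nbrs E v \<subseteq> L})"
proof -
  define I where "I j R' M' \<longleftrightarrow> agree column_regs R R' \<and> R' 6 = j \<and> graph_mem n E (B j) L M' \<and>
    R' 25 = card {v. v < n \<and> v < j \<and> in_nbrs E v \<subseteq> L}" for j R' M'
  have loop: "wp (FOR 7 (columns_body c)) R1 M1 (\<lambda>t R' M'. t \<le> n * ((20 * (n + 1) + 12) + 2) + 1 \<and> R' 7 = 0 \<and> I n R' M')"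
    if "I 0 R1 M1" "R1 7 = n" for R1 M1
  proof (rule wp_FOR[where I = I, OF _ that])
    fix j R1 M1
    assume j: "j < n" and I: "I j R1 M1" and c: "R1 7 = n - j"
    from I have ag: "agree column_regs R R1" and r6: "R1 6 = j" and m: "graph_mem n E (B j) L M1"
      and cnt: "R1 25 = card {v. v < n \<and> v < j \<and> in_nbrs E v \<subseteq> L}" by (simp_all add: I_def)
    have b1: "base_regs n R1" using R agreeD[OF ag] by (simp add: base_regs_def)
    have cnt': "card {v. v < n \<and> v < Suc j \<and> in_nbrs E v \<subseteq> L} =
        card {v. v < n \<and> v < j \<and> in_nbrs E v \<subseteq> L} + of_bool (in_nbrs E j \<subseteq> L)"
      using card_less_Suc[of j "\<lambda>v. v < n \<and> in_nbrs E v \<subseteq> L"] j by (simp add: conj_left_commute)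
    show "wp (columns_body c) R1 M1 (\<lambda>t R' M'. t \<le> 20 * (n + 1) + 12 \<and> R' 7 = n - j \<and> R' 2 = 1 \<and>
        I (Suc j) (R'(7 := n - Suc j)) M')"
      unfolding columns_body_def seqs.simps wp_SEQ
    proof (rule wp_mono[OF wp_scan[OF b1 r6 m j E]])
      fix t R2 M2
      assume A: "t \<le> 20 * (n + 1) \<and> M2 = M1 \<and> agree scan_regs R1 R2 \<and> R2 10 = card (in_nbrs E j - L) \<and>
        (R2 10 \<noteq> 0 \<longrightarrow> (\<exists>u \<in> in_nbrs E j - L. R2 11 = n * n + u))"
      then have t: "t \<le> 20 * (n + 1)" and M2: "M2 = M1" and ag2: "agree scan_regs R1 R2"
        and r10: "R2 10 = card (in_nbrs E j - L)" and r11: "R2 10 \<noteq> 0 \<Longrightarrow> \<exists>u \<in> in_nbrs E j - L. R2 11 = n * n + u"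
        by simp_all
      have b2: "base_regs n R2" using b1 agreeD[OF ag2] by (simp add: base_regs_def)
      have eqs: "R2 6 = j" "R2 7 = n - j" "R2 25 = R1 25" using agreeD[OF ag2] r6 c by simp_all
      have ag3: "agree column_regs R R2" using ag ag2 by (rule agree_trans) auto
      have "finite (in_nbrs E j)" using E by (auto simp: in_nbrs_def intro: finite_subset[of _ "{..<n}"])
      then have z: "R2 10 = 0 \<longleftrightarrow> in_nbrs E j \<subseteq> L" using r10 by simp
      show "wp (IFNZ 10 c (ADD 25 25 2)) R2 M2 (\<lambda>t' R' M'. wp (ADD 6 6 2) R' M' (\<lambda>t'' R' M'. t + (t' + t'') \<le> 20 * (n + 1) + 12 \<and>
          R' 7 = n - j \<and> R' 2 = 1 \<and> I (Suc j) (R'(7 := n - Suc j)) M'))"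
      proof (cases "R2 10 = 0")
        case True
        then show ?thesis using t b2 eqs ag3 m cnt cnt' z skip[OF j] by (simp add: base_regs_def I_def M2)
      next
        case False
        have "wp c R2 M2 (\<lambda>t R' M'. t \<le> 10 \<and> agree {13} R2 R' \<and> graph_mem n E (B (Suc j)) L M')"
          using body[OF j b2 _ r10 r11[OF False]] m M2 by simp
        moreover have "t + (t' + 1 + 1) \<le> 20 * (n + 1) + 12 \<and> R3 7 = n - j \<and> R3 2 = 1 \<and>
            I (Suc j) (R3(6 := R3 6 + R3 2, 7 := n - Suc j)) M3"
          if A: "t' \<le> 10 \<and> agree {13} R2 R3 \<and> graph_mem n E (B (Suc j)) L M3" for t' R3 M3
        proof -
          from A have ag4: "agree {13} R2 R3" by simp
          have "agree column_regs R R3" using ag3 ag4 by (rule agree_trans) auto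
          moreover have "R3 6 = j" "R3 7 = n - j" "R3 2 = 1" "R3 25 = R1 25"
            using agreeD[OF ag4] eqs b2 by (simp_all add: base_regs_def)
          ultimately show ?thesis using A t cnt cnt' z False by (simp add: I_def)
        qed
        ultimately show ?thesis using False by (auto elim!: wp_mono)
      qed
    qed
  qed
  have last: "card {v. v < n \<and> v < n \<and> in_nbrs E v \<subseteq> L} = card {v. v < n \<and> in_nbrs E v \<subseteq> L}" by simp
  show ?thesis
    unfolding columns_def seqs.simps wp_SEQ wp_basic wp_MOV
  proof (rule wp_mono[OF loop], goal_cases)
    case 1
    then show ?case using R M by (simp add: base_regs_def I_def)
  next
    case 2
    then show ?case using R by (simp add: base_regs_def)
  next
    case (3 t R' M')
    then have t: "t \<le> n * ((20 * (n + 1) + 12) + 2) + 1" and I: "I n R' M'" by simp_all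
    have "1 + (1 + (1 + t)) \<le> 40 * ((n + 1) * (n + 1))" using t by (simp add: algebra_simps)
    then show ?case using I by (simp add: I_def last)
  qed
qed

text \<open>Run only when register 10 is nonzero, so that \<open>R 10 - 1 = 0\<close> singles out
  the value 1; register 11 then addresses the flag of the sole in-neighbour.\<close>

definition mark :: com where
  "mark = seqs [SUB 13 10 2, IFNZ 13 (seqs []) (STORE 11 2)]"

text \<open>With empty \<open>L\<close> a single pass yields both the flags of the non-candidates
  and, in register 25, the number of sources.\<close>

lemma wp_columns_mark:
  assumes R: "base_regs n R" and M: "graph_mem n E {} {} M" and E: "E \<subseteq> {..<n} \<times> {..<n}"
  shows "wp (columns mark) R M (\<lambda>t R' M'. t \<le> 40 * ((n + 1) * (n + 1)) \<and> agree column_regs R R' \<and>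
    graph_mem n E (- free_verts E {..<n}) {} M' \<and> R' 25 = card {v. v < n \<and> in_nbrs E v \<subseteq> {}})"
proof -
  let ?B = "\<lambda>j. {u. \<exists>v<j. in_nbrs E v = {u}}"
  have step: "wp mark R M (\<lambda>t R' M'. t \<le> 10 \<and> agree {13} R R' \<and> graph_mem n E (?B (Suc j)) {} M')"
    if j: "j < n" and R: "base_regs n R" and M: "graph_mem n E (?B j) {} M" and c: "R 10 = card (in_nbrs E j - {})"
      and e: "\<exists>u \<in> in_nbrs E j - {}. R 11 = n * n + u" for j R M
  proof -
    obtain u where u: "u \<in> in_nbrs E j" "R 11 = n * n + u" using e by auto
    have un: "u < n" using u E by (auto simp: in_nbrs_def)
    have fin: "finite (in_nbrs E j)" using E by (auto simp: in_nbrs_def intro: finite_subset[of _ "{..<n}"])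
    have pos: "card (in_nbrs E j) \<noteq> 0" using u fin by auto
    show ?thesis
    proof (cases "card (in_nbrs E j) = 1")
      case True
      then have "in_nbrs E j = {u}" using u by (auto simp: card_1_singleton_iff)
      then have "?B (Suc j) = insert u (?B j)" by (auto simp: less_Suc_eq)
      then show ?thesis using mem_mark[OF M un] R True c u by (simp add: mark_def base_regs_def)
    next
      case False
      then have "?B (Suc j) = ?B j" by (auto simp: less_Suc_eq)
      then show ?thesis using M R False pos c by (simp add: mark_def base_regs_def)
    qed
  qed
  have B0: "graph_mem n E (?B 0) {} M" using M by simp
  have "wp (columns mark) R M (\<lambda>t R' M'. t \<le> 40 * ((n + 1) * (n + 1)) \<and> agree column_regs R R' \<and>
    graph_mem n E (?B n) {} M' \<and> R' 25 = card {v. v < n \<and> in_nbrs E v \<subseteq> {}})"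
    by (rule wp_columns[where B = ?B, OF R B0 E step]) (auto simp: less_Suc_eq)
  moreover have "graph_mem n E (- free_verts E {..<n}) {} M'" if "graph_mem n E (?B n) {} M'" for M'
    using that by (rule mem_cong) (auto simp: free_verts_def)
  ultimately show ?thesis by (elim wp_mono) blast
qed

lemma wp_columns_skip:
  assumes R: "base_regs n R" and M: "graph_mem n E B L M" and E: "E \<subseteq> {..<n} \<times> {..<n}"
  shows "wp (columns (seqs [])) R M (\<lambda>t R' M'. t \<le> 40 * ((n + 1) * (n + 1)) \<and> agree column_regs R R' \<and>
    graph_mem n E B L M' \<and> R' 25 = card {v. v < n \<and> in_nbrs E v \<subseteq> L})"
  by (rule wp_columns[where B = "\<lambda>_. B", OF R M E]) simp_all

section \<open>Enumerating the candidate sets\<close>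

definition count_free_body :: com where
  "count_free_body = seqs [LOAD 13 9, IFNZ 13 (seqs []) (seqs [ADD 15 15 2, ADD 16 16 16]), ADD 9 9 2]"

definition count_free :: com where
  "count_free = seqs [LIT 15 0, LIT 16 1, MOV 9 4, MOV 12 0, FOR 12 count_free_body]"

text \<open>Register 16 is doubled once per candidate; its value later serves as the number of
  subsets and as the modulus for reading binary digits.\<close>

lemma wp_count_free:
  assumes R: "base_regs n R" and M: "graph_mem n E (- C) L M"
  shows "wp count_free R M (\<lambda>t R' M'. t \<le> 20 * (n + 1) \<and> agree {9, 12, 13, 15, 16} R R' \<and> M' = M \<and>
    R' 15 = card {u. u < n \<and> u \<in> C} \<and> R' 16 = 2 ^ card {u. u < n \<and> u \<in> C})"
proof -
  define I where "I j R' M' \<longleftrightarrow> agree {9, 12, 13, 15, 16} R R' \<and> M' = M \<and> R' 9 = n * n + j \<and>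
    R' 15 = card {u. u < j \<and> u \<in> C} \<and> R' 16 = 2 ^ card {u. u < j \<and> u \<in> C}" for j R' M'
  have loop: "wp (FOR 12 count_free_body) R1 M1 (\<lambda>t R' M'. t \<le> n * (10 + 2) + 1 \<and> R' 12 = 0 \<and> I n R' M')"
    if "I 0 R1 M1" "R1 12 = n" for R1 M1
  proof (rule wp_FOR[where I = I, OF _ that])
    fix j R1 M1
    assume j: "j < n" and I: "I j R1 M1" and c: "R1 12 = n - j"
    from I have M1: "M1 = M" and ag: "agree {9, 12, 13, 15, 16} R R1" by (simp_all add: I_def)
    have r: "R1 2 = 1" using agreeD[OF ag] R by (simp add: base_regs_def)
    have m: "M (n * n + j) = of_bool (j \<notin> C)" using M j by (simp add: graph_mem_def)
    show "wp count_free_body R1 M1 (\<lambda>t R' M'. t \<le> 10 \<and> R' 12 = n - j \<and> R' 2 = 1 \<and> I (Suc j) (R'(12 := n - Suc j)) M')"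
      using I c r m by (simp add: count_free_body_def I_def M1 card_less_Suc)
  qed
  show ?thesis
    unfolding count_free_def seqs.simps wp_SEQ wp_basic wp_MOV
  proof (rule wp_mono[OF loop], goal_cases)
    case 1
    then show ?case using R by (simp add: base_regs_def I_def)
  next
    case 2
    then show ?case using R by (simp add: base_regs_def)
  next
    case (3 t R' M')
    then show ?case by (simp add: I_def)
  qed
qed

section \<open>Numbering the subsets of the candidates in binary\<close>

definition rank :: "nat set \<Rightarrow> nat \<Rightarrow> nat" where
  "rank C j = card {u. u < j \<and> u \<in> C}"

text \<open>The element of rank \<open>r\<close> belongs to the subset with number \<open>x\<close> iff the digit of weight
  \<open>2 ^ (c - 1 - r)\<close> of \<open>x\<close> is 1. With this order the machine, which can neither divide nor shift
  right, obtains the digits by doubling \<open>x\<close> modulo \<open>2 ^ c\<close>.\<close>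

definition nth_subset :: "nat set \<Rightarrow> nat \<Rightarrow> nat \<Rightarrow> nat set" where
  "nth_subset C c x = {u \<in> C. 2 ^ c \<le> 2 * ((x * 2 ^ rank C u) mod 2 ^ c)}"

lemma rank_Suc: "rank C (Suc j) = rank C j + of_bool (j \<in> C)"
  unfolding rank_def by (rule card_less_Suc)

lemma rank_less:
  assumes "u \<in> C" "u < w"
  shows "rank C u < rank C w"
  unfolding rank_def using assms by (intro psubset_card_mono) auto

text \<open>Multiplication by \<open>2 ^ r\<close> modulo \<open>2 ^ c\<close> shifts the digit of
  weight \<open>2 ^ (c - Suc r)\<close> to the top and drops those above it. A number below
  \<open>2 ^ c\<close> has top digit 1 iff its double reaches \<open>2 ^ c\<close>.\<close>

lemma binary_digit_iff:
  fixes x :: nat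
  assumes "r < c"
  shows "2 ^ c \<le> 2 * ((x * 2 ^ r) mod 2 ^ c) \<longleftrightarrow> odd (x div 2 ^ (c - Suc r))"
proof -
  define i where "i = c - Suc r"
  have c: "c = Suc i + r" using assms by (simp add: i_def)
  have "(x * 2 ^ r) mod 2 ^ c = (x mod 2 ^ Suc i) * 2 ^ r"
    unfolding c power_add by (rule mod_mult_mult2)
  moreover have "2 ^ c = (2 ^ i * 2) * (2 ^ r :: nat)" unfolding c power_add by simp
  ultimately have "2 ^ c \<le> 2 * ((x * 2 ^ r) mod 2 ^ c) \<longleftrightarrow> 2 ^ i \<le> x mod 2 ^ Suc i" by simp
  also have "x mod 2 ^ Suc i = 2 ^ i * (x div 2 ^ i mod 2) + x mod 2 ^ i"
    using mod_mult2_eq[of x "2 ^ i" 2] by (simp add: mult.commute)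
  also have "2 ^ i \<le> \<dots> \<longleftrightarrow> odd (x div 2 ^ i)"
    using mod_less_divisor[of "2 ^ i" x] by (cases "even (x div 2 ^ i)") (auto simp: odd_iff_mod_2_eq_one not_le)
  finally show ?thesis by (simp add: i_def)
qed

lemma set_encode_less:
  assumes "A \<subseteq> {..<c}"
  shows "set_encode A < 2 ^ c"
proof -
  have "set_encode A \<le> (\<Sum>i<c. 2 ^ i)" unfolding set_encode_def using assms by (intro sum_mono2) auto
  also have "\<dots> < 2 ^ c" by (simp add: sum_power2 atLeast0LessThan[symmetric])
  finally show ?thesis .
qed

lemma nth_subset_surj:
  assumes C: "C \<subseteq> {..<n}" and S: "S \<subseteq> C"
  obtains x where "x < 2 ^ rank C n" "nth_subset C (rank C n) x = S"
proof -
  define c where "c = rank C n"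
  define idx where "idx u = c - Suc (rank C u)" for u
  have rc: "rank C u < c" if "u \<in> C" for u
    unfolding c_def using that C by (intro rank_less) auto
  have inj: "inj_on idx C"
  proof (rule linorder_inj_onI)
    fix u w assume "u < w" "u \<in> C" "w \<in> C"
    then show "idx u \<noteq> idx w" using rank_less[of u C w] rc[of u] rc[of w] by (simp add: idx_def)
  qed auto
  \<comment> \<open>The number whose digits 1 stand exactly at the positions \<open>idx u\<close> of
    the members \<open>u\<close> of \<open>S\<close>.\<close>
  let ?x = "set_encode (idx ` S)"
  have "finite S" using finite_subset[OF subset_trans[OF S C]] by simp
  then have dec: "set_decode ?x = idx ` S" by simp
  have "idx u < c" if "u \<in> C" for u using rc[OF that] by (simp add: idx_def)
  then have "idx ` S \<subseteq> {..<c}" using S by auto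
  then have "?x < 2 ^ c" by (rule set_encode_less)
  moreover have "u \<in> nth_subset C c ?x \<longleftrightarrow> u \<in> S" if "u \<in> C" for u
  proof -
    have "u \<in> nth_subset C c ?x \<longleftrightarrow> idx u \<in> set_decode ?x"
      using that binary_digit_iff[OF rc[OF that]] by (simp add: nth_subset_def idx_def set_decode_def)
    also have "\<dots> \<longleftrightarrow> u \<in> S" unfolding dec using inj that S by (auto dest: inj_onD)
    finally show ?thesis .
  qed
  then have "nth_subset C c ?x = S" using S by (auto simp: nth_subset_def)
  ultimately show thesis using that by (simp add: c_def)
qed

section \<open>Reading off one subset by machine\<close>

abbreviation "decode_regs \<equiv> {9, 12, 13, 22, 23, 24 :: nat}"

definition decode_body :: com where
  "decode_body = seqs [LOAD 13 9, IFNZ 13 (seqs []) (seqs [ADD 22 22 22, ADD 13 22 2, SUB 13 13 16,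
     IFNZ 13 (seqs [SUB 22 22 16, STORE 24 2, ADD 23 23 2]) (STORE 24 31)]), ADD 9 9 2, ADD 24 24 2]"

definition decode :: com where
  "decode = seqs [MOV 22 19, LIT 23 0, MOV 9 4, MOV 24 5, MOV 12 0, FOR 12 decode_body]"

text \<open>\<open>L\<close> is what the flags held before, such as the previous subset. The flags
  of all candidates are rewritten, by 0 or by 1, and no others are touched; so
  \<open>L \<subseteq> C\<close> ensures that nothing stale remains.\<close>

lemma wp_decode:
  assumes R: "base_regs n R" "R 16 = 2 ^ c" "R 19 = x" "x < 2 ^ c" and M: "graph_mem n E (- C) L M"
    and C: "C \<subseteq> {..<n}" and L: "L \<subseteq> C"
  shows "wp decode R M (\<lambda>t R' M'. t \<le> 20 * (n + 1) \<and> agree decode_regs R R' \<and>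
    graph_mem n E (- C) (nth_subset C c x) M' \<and> R' 23 = card (nth_subset C c x))"
proof -
  define S where "S = nth_subset C c x"
  \<comment> \<open>Below \<open>j\<close> the flags already describe \<open>S\<close>, from
    \<open>j\<close> on still \<open>L\<close>.\<close>
  define I where "I j R' M' \<longleftrightarrow> agree decode_regs R R' \<and> R' 9 = n * n + j \<and> R' 24 = n * n + n + j \<and>
    R' 22 = (x * 2 ^ rank C j) mod 2 ^ c \<and> R' 23 = card {u. u < j \<and> u \<in> S} \<and>
    graph_mem n E (- C) ({u \<in> S. u < j} \<union> {u \<in> L. j \<le> u}) M'" for j R' M'
  have loop: "wp (FOR 12 decode_body) R1 M1 (\<lambda>t R' M'. t \<le> n * (13 + 2) + 1 \<and> R' 12 = 0 \<and> I n R' M')"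
    if "I 0 R1 M1" "R1 12 = n" for R1 M1
  proof (rule wp_FOR[where I = I, OF _ that])
    fix j R1 M1
    assume j: "j < n" and I: "I j R1 M1" and cnt: "R1 12 = n - j"
    define y where "y = (x * 2 ^ rank C j) mod 2 ^ c"
    from I have ag: "agree decode_regs R R1" and r9: "R1 9 = n * n + j" and r24: "R1 24 = n * n + n + j"
      and r22: "R1 22 = y" and r23: "R1 23 = card {u. u < j \<and> u \<in> S}"
      and m1: "graph_mem n E (- C) ({u \<in> S. u < j} \<union> {u \<in> L. j \<le> u}) M1" by (simp_all add: I_def y_def)
    have r: "R1 2 = 1" "R1 31 = 0" "R1 16 = 2 ^ c" using agreeD[OF ag] R by (simp_all add: base_regs_def)
    have m: "M1 (n * n + j) = of_bool (j \<notin> C)" using m1 j by (simp add: graph_mem_def)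
    show "wp decode_body R1 M1 (\<lambda>t R' M'. t \<le> 13 \<and> R' 12 = n - j \<and> R' 2 = 1 \<and> I (Suc j) (R'(12 := n - Suc j)) M')"
    proof (cases "j \<in> C")
      case False
      then have jS: "j \<notin> S" "j \<notin> L" using L by (auto simp: S_def nth_subset_def)
      have "graph_mem n E (- C) ({u \<in> S. u < Suc j} \<union> {u \<in> L. Suc j \<le> u}) M1"
        using m1 by (rule mem_cong) (use jS in \<open>auto simp: less_Suc_eq Suc_le_eq le_less\<close>)
      then show ?thesis
        using False ag r9 r24 r22 r23 r m cnt jS
        by (simp add: decode_body_def I_def card_less_Suc rank_Suc y_def)
    next
      case True
      have yP: "y < 2 ^ c" by (simp add: y_def)
      have "(x * 2 ^ rank C (Suc j)) mod 2 ^ c = (2 * y) mod 2 ^ c"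
        using True by (simp add: y_def rank_Suc mod_mult_right_eq ac_simps)
      \<comment> \<open>As \<open>y\<close> is below the modulus, reducing \<open>2 * y\<close>
        takes at most one subtraction.\<close>
      also have "\<dots> = (if 2 ^ c \<le> 2 * y then 2 * y - 2 ^ c else 2 * y)"
        using yP by (auto simp: le_mod_geq)
      finally have y': "(x * 2 ^ rank C (Suc j)) mod 2 ^ c = (if 2 ^ c \<le> 2 * y then 2 * y - 2 ^ c else 2 * y)" .
      have jS: "j \<in> S \<longleftrightarrow> 2 ^ c \<le> 2 * y" using True by (simp add: S_def nth_subset_def y_def)
      have "graph_mem n E (- C) ({u \<in> S. u < Suc j} \<union> {u \<in> L. Suc j \<le> u}) (M1(n * n + n + j := of_bool (j \<in> S)))"
        using m1 j by (rule mem_set_flag) (auto simp: less_Suc_eq Suc_le_eq le_less)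
      note m2 = this[unfolded jS]
      show ?thesis
      proof (cases "2 ^ c \<le> 2 * y")
        case d: True
        have s: "y + y + 1 - 2 ^ c \<noteq> 0" "y + y = 2 * y" using d by simp_all
        show ?thesis
          using True d s ag r9 r24 r22 r23 r m cnt jS m2 y'
          by (simp add: decode_body_def I_def card_less_Suc)
      next
        case d: False
        have s: "y + y + 1 - 2 ^ c = 0" "y + y = 2 * y" using d by simp_all
        show ?thesis
          using True d s ag r9 r24 r22 r23 r m cnt jS m2 y'
          by (simp add: decode_body_def I_def card_less_Suc)
      qed
    qed
  qed
  have SC: "S \<subseteq> {..<n}" using C by (auto simp: S_def nth_subset_def)
  show ?thesis
    unfolding decode_def seqs.simps wp_SEQ wp_basic wp_MOV
  proof (rule wp_mono[OF loop], goal_cases)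
    case 1
    have "{u \<in> S. u < 0} \<union> {u \<in> L. 0 \<le> u} = L" by auto
    then show ?case using R M by (simp add: base_regs_def I_def rank_def)
  next
    case 2
    then show ?case using R by (simp add: base_regs_def)
  next
    case (3 t R' M')
    then have t: "t \<le> n * (13 + 2) + 1" and I: "I n R' M'" by simp_all
    have "{u. u < n \<and> u \<in> S} = S" "{u \<in> S. u < n} \<union> {u \<in> L. n \<le> u} = S" using SC L C by auto
    with t I show ?case by (simp add: I_def S_def)
  qed
qed

abbreviation "enum_regs \<equiv> {19, 20, 21, 27, 28 :: nat} \<union> decode_regs \<union> column_regs"

text \<open>Register 27 is 0 iff exactly one vertex has all in-neighbours in the current set and that set has at
  least \<open>k\<close> elements.\<close>

definition enum_body :: com where
  "enum_body = seqs [decode, columns (seqs []), SUB 27 25 2, SUB 28 2 25, ADD 27 27 28, SUB 28 1 23,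
     ADD 27 27 28, IFNZ 27 (seqs []) (LIT 21 1), ADD 19 19 2]"

definition enum :: com where
  "enum = seqs [LIT 19 0, MOV 20 16, LIT 21 0, FOR 20 enum_body]"

text \<open>Register 21 is set by a successful round and never reset within the loop, so it collects
  the disjunction over all numbers below \<open>2 ^ rank C n\<close>; by
  \<open>nth_subset_surj\<close> these reach every subset of \<open>C\<close>.\<close>

lemma wp_enum:
  assumes R: "base_regs n R" "R 1 = k" "R 16 = 2 ^ rank C n" and M: "graph_mem n E (- C) {} M"
    and C: "C \<subseteq> {..<n}" and E: "E \<subseteq> {..<n} \<times> {..<n}"
  shows "wp enum R M (\<lambda>t R' M'. t \<le> 100 * (2 ^ rank C n * ((n + 1) * (n + 1))) \<and> agree enum_regs R R' \<and>
    R' 21 = of_bool (\<exists>L \<subseteq> C. k \<le> card L \<and> card {v. v < n \<and> in_nbrs E v \<subseteq> L} = 1))"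
proof -
  define c where "c = rank C n"
  define good where "good L \<longleftrightarrow> k \<le> card L \<and> card {v. v < n \<and> in_nbrs E v \<subseteq> L} = 1" for L
  define I where "I j R' M' \<longleftrightarrow> agree enum_regs R R' \<and> R' 19 = j \<and>
    R' 21 = of_bool (\<exists>x<j. good (nth_subset C c x)) \<and> (\<exists>L \<subseteq> C. graph_mem n E (- C) L M')" for j R' M'
  \<comment> \<open>Bounds for \<open>decode\<close> and \<open>columns\<close>, with room for the 8
    further units of a round.\<close>
  define B where "B = 20 * (n + 1) + 40 * ((n + 1) * (n + 1)) + 10"
  have loop: "wp (FOR 20 enum_body) R1 M1 (\<lambda>t R' M'. t \<le> 2 ^ c * (B + 2) + 1 \<and> R' 20 = 0 \<and> I (2 ^ c) R' M')"
    if "I 0 R1 M1" "R1 20 = 2 ^ c" for R1 M1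
  proof (rule wp_FOR[where I = I, OF _ that])
    fix x R1 M1
    assume x: "x < 2 ^ c" and I: "I x R1 M1" and cnt: "R1 20 = 2 ^ c - x"
    from I obtain L where ag: "agree enum_regs R R1" and r19: "R1 19 = x"
      and r21: "R1 21 = of_bool (\<exists>x'<x. good (nth_subset C c x'))"
      and L: "L \<subseteq> C" and m1: "graph_mem n E (- C) L M1" by (auto simp: I_def)
    have b1: "base_regs n R1" and r16: "R1 16 = 2 ^ c" using agreeD[OF ag] R by (simp_all add: base_regs_def c_def)
    let ?S = "nth_subset C c x"
    show "wp enum_body R1 M1 (\<lambda>t R' M'. t \<le> B \<and> R' 20 = 2 ^ c - x \<and> R' 2 = 1 \<and>
        I (Suc x) (R'(20 := 2 ^ c - Suc x)) M')"
      unfolding enum_body_def seqs.simps wp_SEQ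
    proof (rule wp_mono[OF wp_decode[OF b1 r16 r19 x m1 C L]])
      fix t2 R2 M2
      assume "t2 \<le> 20 * (n + 1) \<and> agree decode_regs R1 R2 \<and> graph_mem n E (- C) ?S M2 \<and> R2 23 = card ?S"
      then have t2: "t2 \<le> 20 * (n + 1)" and ag12: "agree decode_regs R1 R2" and m2: "graph_mem n E (- C) ?S M2"
        and r23: "R2 23 = card ?S" by simp_all
      have b2: "base_regs n R2" using b1 agreeD[OF ag12] by (simp add: base_regs_def)
      show "wp (columns (LIT 13 0)) R2 M2 (\<lambda>t R' M'. wp (SUB 27 25 2) R' M' (\<lambda>t' R' M'. wp (SUB 28 2 25) R' M' (\<lambda>t'a R' M'.
        wp (ADD 27 27 28) R' M' (\<lambda>t'b R' M'. wp (SUB 28 1 23) R' M' (\<lambda>t'c R' M'. wp (ADD 27 27 28) R' M' (\<lambda>t'd R' M'.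
        wp (IFNZ 27 (LIT 13 0) (LIT 21 1)) R' M' (\<lambda>t'e R' M'. wp (ADD 19 19 2) R' M' (\<lambda>t'f R' M'.
          t2 + (t + (t' + (t'a + (t'b + (t'c + (t'd + (t'e + t'f))))))) \<le> B \<and> R' 20 = 2 ^ c - x \<and> R' 2 = 1 \<and>
          I (Suc x) (R'(20 := 2 ^ c - Suc x)) M'))))))))"
      proof (rule wp_mono[OF wp_columns_skip[OF b2 m2 E, unfolded seqs.simps]], goal_cases)
        case (1 t3 R3 M3)
        then have t3: "t3 \<le> 40 * ((n + 1) * (n + 1))" and ag23: "agree column_regs R2 R3" and m3: "graph_mem n E (- C) ?S M3"
          and r25: "R3 25 = card {v. v < n \<and> in_nbrs E v \<subseteq> ?S}" by simp_all
        have "agree (decode_regs \<union> column_regs) R1 R3" using ag12 ag23 by (rule agree_trans) auto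
        with ag have ag3: "agree enum_regs R R3" by (rule agree_trans) auto
        have r3: "R3 2 = 1" "R3 20 = 2 ^ c - x" "R3 19 = x" "R3 21 = R1 21" "R3 23 = card ?S" "R3 1 = k"
          using agreeD[OF ag12] agreeD[OF ag23] agreeD[OF ag] b1 cnt r19 r23 R by (simp_all add: base_regs_def)
        have ex: "\<exists>L \<subseteq> C. graph_mem n E (- C) L M3" using m3 by (intro exI[of _ ?S]) (auto simp: nth_subset_def)
        \<comment> \<open>A sum of truncated differences is 0 iff each is: the first two force
          register 25 to be 1, the third compares \<open>k\<close> with the size of the set.\<close>
        have test: "R3 25 - 1 + (1 - R3 25) + (k - card ?S) = 0 \<longleftrightarrow> good ?S" by (auto simp: good_def r25)
        have time: "t2 + (t3 + 8) \<le> B" using t2 t3 by (simp add: B_def)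
        show ?case
        proof (cases "good ?S")
          case True
          then have "R3 25 - 1 + (1 - R3 25) + (k - card ?S) = 0" using test by simp
          then show ?thesis using ag3 r3 ex time True by (auto simp: I_def less_Suc_eq)
        next
          case False
          have "R3 25 = 0 \<or> 1 < R3 25 \<or> card ?S < k" using False by (auto simp: good_def r25[symmetric])
          moreover have "(\<exists>x'<Suc x. good (nth_subset C c x')) \<longleftrightarrow> (\<exists>x'<x. good (nth_subset C c x'))"
            using False by (auto simp: less_Suc_eq)
          ultimately show ?thesis using ag3 r3 ex time r21 by (auto simp: I_def)
        qed
      qed
    qed
  qed
  have all: "(\<exists>x<2 ^ c. good (nth_subset C c x)) \<longleftrightarrow> (\<exists>L \<subseteq> C. good L)"
  proof
    assume "\<exists>L \<subseteq> C. good L"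
    then obtain L where "L \<subseteq> C" "good L" by blast
    then show "\<exists>x<2 ^ c. good (nth_subset C c x)" using nth_subset_surj[OF C, of L] unfolding c_def by metis
  next
    have "nth_subset C c x \<subseteq> C" for x by (auto simp: nth_subset_def)
    then show "\<exists>L \<subseteq> C. good L" if "\<exists>x<2 ^ c. good (nth_subset C c x)" using that by blast
  qed
  show ?thesis
    unfolding enum_def seqs.simps wp_SEQ wp_basic wp_MOV
  proof (rule wp_mono[OF loop], goal_cases)
    case 1
    have "\<exists>L \<subseteq> C. graph_mem n E (- C) L M" using M by blast
    then show ?case using R by (simp add: base_regs_def I_def)
  next
    case 2
    then show ?case using R by (simp add: base_regs_def c_def)
  next
    case (3 t R' M')
    then have t: "t \<le> 2 ^ c * (B + 2) + 1" and I: "I (2 ^ c) R' M'" by simp_all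
    have "1 \<le> (2 :: nat) ^ c" by simp
    then have "1 + (1 + (1 + t)) \<le> 2 ^ c * (B + 6)" using t unfolding add_mult_distrib2 by linarith
    also have "\<dots> \<le> 2 ^ c * (100 * ((n + 1) * (n + 1)))" by (intro mult_left_mono) (simp_all add: B_def algebra_simps)
    also have "\<dots> = 100 * (2 ^ c * ((n + 1) * (n + 1)))" by (rule mult.left_commute)
    finally show ?case using I all by (simp add: I_def good_def c_def)
  qed
qed

section \<open>The complete program\<close>

definition dmlob_prog :: com where
  "dmlob_prog = seqs [LIT 2 1, MOV 3 0, FOR 3 (ADD 4 4 0), ADD 5 4 0, columns mark, count_free,
     ADD 18 15 2, SUB 18 18 1, SUB 18 18 1, SUB 18 18 1,
     IFNZ 18 (seqs [SUB 27 25 2, SUB 28 2 25, ADD 27 27 28, IFNZ 27 (LIT 0 0) (LIT 0 1)])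
       (seqs [enum, MOV 0 21])]"

text \<open>Without a multiplication instruction, the address \<open>n * n\<close> is obtained by
  \<open>n\<close> additions.\<close>

lemma wp_square:
  assumes "R 2 = 1" "R 4 = 0" "R 3 = n" "R 0 = n"
  shows "wp (FOR 3 (ADD 4 4 0)) R M (\<lambda>t R' M'. t \<le> n * 3 + 1 \<and> M' = M \<and> agree {3, 4} R R' \<and> R' 4 = n * n)"
proof -
  define I where "I j R' M' \<longleftrightarrow> M' = M \<and> agree {3, 4} R R' \<and> R' 4 = j * n" for j R' M'
  have "wp (FOR 3 (ADD 4 4 0)) R M (\<lambda>t R' M'. t \<le> n * (1 + 2) + 1 \<and> R' 3 = 0 \<and> I n R' M')"
  proof (rule wp_FOR[where I = I])
    fix j R1 M1
    assume j: "j < n" and I: "I j R1 M1" and c: "R1 3 = n - j"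
    then have "R1 0 = n" "R1 2 = 1" using agreeD[of "{3, 4}" R R1] assms by (simp_all add: I_def)
    then show "wp (ADD 4 4 0) R1 M1 (\<lambda>t R' M'. t \<le> 1 \<and> R' 3 = n - j \<and> R' 2 = 1 \<and> I (Suc j) (R'(3 := n - Suc j)) M')"
      using I c by (simp add: I_def)
  qed (use assms in \<open>simp_all add: I_def\<close>)
  then show ?thesis by (rule wp_mono) (simp add: I_def)
qed

lemma dmlob_prog_answers:
  assumes E: "E \<subseteq> {..<n} \<times> {..<n}" and M: "graph_mem n E {} {} M"
  defines "V \<equiv> {..<n}"
  shows "wp dmlob_prog ((\<lambda>_. 0)(0 := n, 1 := k)) M (\<lambda>t R' M'. t \<le> 1000 * (8 ^ k * ((n + 1) * (n + 1))) \<and>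
    R' 0 = of_bool (if 3 * k \<le> card (free_verts E V) then card {v \<in> V. in_nbrs E v \<subseteq> {}} = 1
      else \<exists>L \<subseteq> free_verts E V. k \<le> card L \<and> card {v \<in> V. in_nbrs E v \<subseteq> L} = 1))"
    (is "wp _ _ _ (\<lambda>t R' M'. t \<le> ?T \<and> R' 0 = of_bool ?A)")
proof -
  let ?m = "(n + 1) * (n + 1)"
  define T where "T = ?T"
  define A where "A \<longleftrightarrow> ?A"
  define C where "C = free_verts E V"
  have CV: "C \<subseteq> {..<n}" by (auto simp: C_def V_def free_verts_def)
  have rk: "card {u. u < n \<and> u \<in> C} = rank C n" by (simp add: rank_def)
  have "{u. u < n \<and> u \<in> C} = C" using CV by auto
  then have cC: "card C = rank C n" using rk by simp
  have V: "{v. v < n \<and> P v} = {v \<in> V. P v}" for P by (simp add: V_def)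
  define R0 :: "nat \<Rightarrow> nat" where "R0 = ((\<lambda>_. 0)(0 := n, 1 := k, 2 := 1, 3 := n))"
  have k8: "(1 :: nat) \<le> 8 ^ k" by simp
  \<comment> \<open>Brings the polynomial costs, paid in both branches, under the common
    bound.\<close>
  have k8m: "?m \<le> 8 ^ k * ?m" using mult_right_mono[OF k8, of ?m] by simp
  show ?thesis
    unfolding T_def[symmetric] A_def[symmetric] dmlob_prog_def seqs.simps wp_SEQ wp_basic wp_MOV
  proof (rule wp_mono[OF wp_square[of _ n]], goal_cases)
    case (5 t1 R1 M1)
    then have t1: "t1 \<le> n * 3 + 1" and M1: "M1 = M" and ag1: "agree {3, 4} R0 R1" and r4: "R1 4 = n * n"
      by (simp_all add: R0_def)
    have b1: "base_regs n (R1(5 := n * n + n))" "R1 0 = n" "R1 1 = k" using agreeD[OF ag1] r4 by (simp_all add: base_regs_def R0_def)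
    show ?case
      unfolding r4 b1(2) M1
    proof (rule wp_mono[OF wp_columns_mark[OF b1(1) M E]], goal_cases)
      case (1 t2 R2 M2)
      then have t2: "t2 \<le> 40 * ?m" and ag2: "agree column_regs (R1(5 := n * n + n)) R2"
        and m2: "graph_mem n E (- C) {} M2" and src: "R2 25 = card {v \<in> V. in_nbrs E v \<subseteq> {}}"
        by (simp_all add: C_def V_def)
      have b2: "base_regs n R2" "R2 1 = k" using b1 agreeD[OF ag2] by (simp_all add: base_regs_def)
      show ?case
      proof (rule wp_mono[OF wp_count_free[OF b2(1) m2]], goal_cases)
        case (1 t3 R3 M3)
        then have t3: "t3 \<le> 20 * (n + 1)" and ag3: "agree {9, 12, 13, 15, 16} R2 R3" and M3: "M3 = M2"
          and r15: "R3 15 = rank C n" and r16: "R3 16 = 2 ^ rank C n" by (simp_all add: rk)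
        have b3: "base_regs n R3" "R3 1 = k" "R3 2 = 1" "R3 25 = R2 25" using b2 agreeD[OF ag3] by (simp_all add: base_regs_def)
        have t123: "t1 + t2 + t3 + 50 \<le> 300 * ?m" using t1 t2 t3 by (simp add: algebra_simps)
        \<comment> \<open>The added 1 keeps the truncated difference nonzero when
          \<open>3 * k = card C\<close>.\<close>
        have test: "rank C n + 1 - k - k - k \<noteq> 0 \<longleftrightarrow> 3 * k \<le> card C" by (auto simp: cC)
        show ?case
        proof (cases "3 * k \<le> card C")
          case True
          have A: "A \<longleftrightarrow> R3 25 = 1" using True src b3 by (simp add: A_def C_def)
          have "t1 + t2 + t3 + 50 \<le> T" using t123 k8m unfolding T_def by linarith
          moreover have "R3 25 - 1 + (1 - R3 25) = 0 \<longleftrightarrow> R3 25 = 1" by auto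
          ultimately show ?thesis using True test b3 r15 A by (simp add: M3)
        next
          case False
          let ?R = "R3(18 := R3 15 + R3 2, 18 := R3 15 + R3 2 - k, 18 := R3 15 + R3 2 - k - k, 18 := R3 15 + R3 2 - k - k - k)"
          have R: "base_regs n ?R" "?R 1 = k" "?R 16 = 2 ^ rank C n" using b3 r16 by (simp_all add: base_regs_def)
          have A: "A \<longleftrightarrow> (\<exists>L \<subseteq> C. k \<le> card L \<and> card {v. v < n \<and> in_nbrs E v \<subseteq> L} = 1)"
            using False by (simp add: A_def C_def V)
          \<comment> \<open>Enumeration is reached only with fewer than \<open>3 * k\<close>
            candidates, so at most \<open>8 ^ k\<close> subsets are tried.\<close>
          have "(2 :: nat) ^ rank C n \<le> 2 ^ (3 * k)" using False cC by (intro power_increasing) simp_all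
          then have "2 ^ rank C n \<le> (8 :: nat) ^ k" by (simp add: power_mult)
          then have le: "2 ^ rank C n * ?m \<le> 8 ^ k * ?m" by (rule mult_right_mono) simp
          have "wp enum ?R M2 (\<lambda>t R' M'. t1 + t2 + t3 + 50 + t \<le> T \<and> R' 31 = 0 \<and> R' 21 = of_bool A)"
          proof (rule wp_mono[OF wp_enum[OF R m2 CV E]], goal_cases)
            case (1 t R' M')
            then have "t \<le> 100 * (2 ^ rank C n * ?m)" and ag: "agree enum_regs ?R R'" by blast+
            then have "t1 + t2 + t3 + 50 + t \<le> T" using t123 k8m le unfolding T_def by linarith
            moreover have "R' 31 = 0" using agreeD[OF ag] b3 by (simp add: base_regs_def)
            moreover have "R' 21 = of_bool A" using 1 unfolding A by (elim conjE)
            ultimately show ?case by (intro conjI)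
          qed
          moreover have "R3 15 + R3 2 - k - k - k = 0" using False test r15 b3 by simp
          ultimately show ?thesis using b3 by (cases A) (simp add: M3, elim wp_mono, simp)+
        qed
      qed
    qed
  qed simp_all
qed

theorem corollary1:
  shows "\<exists>(P :: com) (T :: nat \<Rightarrow> nat \<Rightarrow> nat) (g :: nat \<Rightarrow> real) (h :: nat \<Rightarrow> real).
    (\<forall>(n::nat) (D :: nat pair_pre_digraph) (k::nat).
       pair_digraph D \<and> acyclic_digraph (with_proj D) \<and> pverts D = {..<n} \<and> 1 \<le> k \<longrightarrow>
       answers_within P (encode_instance D k) (T n k) (DMLOB (with_proj D) k)) \<and>
    g \<in> O(\<lambda>k. real k * log 2 (real k)) \<and>
    h \<in> O(\<lambda>n. 1) \<and>
    (\<forall>n k. 1 \<le> n \<longrightarrow> 1 \<le> k \<longrightarrow> real (T n k) \<le> 2 powr g k * real n powr h n)"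
proof (intro exI conjI allI impI)
  \<comment> \<open>The witnesses are \<open>dmlob_prog\<close>, the bound of
    \<open>dmlob_prog_answers\<close> as \<open>T\<close>, the function
    \<open>12 + 3 * real k\<close> as \<open>g\<close> and the constant 2 as
    \<open>h\<close>.\<close>
  fix n k :: nat and D :: "nat pair_pre_digraph"
  assume A: "pair_digraph D \<and> acyclic_digraph (with_proj D) \<and> pverts D = {..<n} \<and> 1 \<le> k"
  then interpret pair_digraph D by simp
  have V: "pverts D = {..<n}" using A by simp
  have E: "parcs D \<subseteq> {..<n} \<times> {..<n}" using in_arcsD1 in_arcsD2 V by auto
  define M where "M a = (if (a div n, a mod n) \<in> parcs D then 1 else 0 :: nat)" for a
  have enc: "encode_instance D k = ((\<lambda>_. 0)(0 := n, 1 := k), M)"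
    unfolding encode_instance_def M_def V by simp
  \<comment> \<open>From address \<open>n * n\<close> on, the row \<open>a div n\<close> is no
    vertex; hence both flag arrays start out empty.\<close>
  have outside: "M a = 0" if "n * n \<le> a" for a
  proof -
    have "(a div n, a mod n) \<notin> {..<n} \<times> {..<n}"
      using that by (cases "n = 0") (auto simp: less_eq_div_iff_mult_less_eq not_less)
    then show ?thesis using E by (auto simp: M_def)
  qed
  have "M (u * n + v) = of_bool ((u, v) \<in> parcs D)" if "u < n" "v < n" for u v
    using that by (simp add: M_def)
  then have M: "graph_mem n (parcs D) {} {} M" by (simp add: graph_mem_def outside)
  have "wp dmlob_prog ((\<lambda>_. 0)(0 := n, 1 := k)) M (\<lambda>t R' M'. t \<le> 1000 * (8 ^ k * ((n + 1) * (n + 1))) \<and>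
      R' 0 = of_bool (DMLOB (with_proj D) k))"
  proof -
    have "DMLOB (with_proj D) k \<longleftrightarrow> (if 3 * k \<le> card (free_verts (parcs D) {..<n})
      then card {v \<in> {..<n}. in_nbrs (parcs D) v \<subseteq> {}} = 1
      else \<exists>L \<subseteq> free_verts (parcs D) {..<n}. k \<le> card L \<and> card {v \<in> {..<n}. in_nbrs (parcs D) v \<subseteq> L} = 1)"
      unfolding V[symmetric] by (rule DMLOB_decision) (use A in auto)
    then show ?thesis using dmlob_prog_answers[OF E M, of k] by (simp only:)
  qed
  then obtain t R' M' where "exec dmlob_prog (encode_instance D k) t (R', M')"
    "t \<le> 1000 * (8 ^ k * ((n + 1) * (n + 1)))" "R' 0 = of_bool (DMLOB (with_proj D) k)"
    unfolding wp_def enc by blast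
  then show "answers_within dmlob_prog (encode_instance D k) (1000 * (8 ^ k * ((n + 1) * (n + 1)))) (DMLOB (with_proj D) k)"
    unfolding answers_within_def of_bool_def by blast
next
  show "(\<lambda>k. 12 + 3 * real k) \<in> O(\<lambda>k. real k * log 2 (real k))" by real_asymp
  show "(\<lambda>n. 2) \<in> O(\<lambda>n. 1 :: real)" by simp
next
  fix n k :: nat
  assume n: "1 \<le> n" and "1 \<le> k"
  \<comment> \<open>For positive \<open>n\<close> the square costs a factor 4, and
    \<open>4 * 1000 \<le> 2 ^ 12\<close> explains the constant 12 in the exponent; the 3 comes from
    \<open>8 = 2 ^ 3\<close>.\<close>
  have "(n + 1) * (n + 1) \<le> (2 * n) * (2 * n)" using n by (intro mult_mono) auto
  then have "1000 * (8 ^ k * ((n + 1) * (n + 1))) \<le> 1000 * (8 ^ k * ((2 * n) * (2 * n)))" by (intro mult_left_mono) simp_all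
  also have "\<dots> \<le> 2 ^ 12 * 8 ^ k * n ^ 2" by (simp add: power2_eq_square)
  finally have "real (1000 * (8 ^ k * ((n + 1) * (n + 1)))) \<le> real (2 ^ 12 * 8 ^ k * n ^ 2)" by (rule of_nat_mono)
  also have "\<dots> = 2 powr (12 + 3 * real k) * real n powr 2"
  proof -
    have "2 powr (3 * real k) = (2 powr 3) powr real k" by (rule powr_powr[symmetric])
    then show ?thesis using n by (simp add: powr_add powr_realpow)
  qed
  finally show "real (1000 * (8 ^ k * ((n + 1) * (n + 1)))) \<le> 2 powr (12 + 3 * real k) * real n powr 2" .
qed

end
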